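(* Let $(R,B,L)$ be a Hadamard system in $\mathbb{R}^d$, let $T_B,T_L$ be the associated transfer operators, let $E_+(T_B),E_+(T_L)$ be the associated sets of fixed functions, and let $\mathbf 1$ be the constant function one on $\mathbb{R}^d$. Then $$\mathbf 1\in E_+(T_B)\cap E_+(T_L),\qquad \sigma_{\Gamma(L)}^{(B)}\in E_+(T_B),\qquad \sigma_{\Gamma(B)}^{(L)}\in E_+(T_L).$$ Moreover, each of $E_+(T_B)$ and $E_+(T_L)$ is a convex order interval; specifically: if $f\in E_+(T_B)$ then $\sigma_{\Gamma(L)}^{(B)}(t)\le f(t)\le 1$ for all $t\in\mathbb{R}^d$, and similarly if $f\in E_+(T_L)$ then $\sigma_{\Gamma(B)}^{(L)}(t)\le f(t)\le 1$ for all $t\in\mathbb{R}^d$.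
   Context: Hadamard system $(R,B,L)$ in $\mathbb{R}^d$: $R$ is a $d\times d$ matrix with integer entries which is expansive (all eigenvalues $\lambda$ satisfy $|\lambda|>1$); $B,L\subset\mathbb{R}^d$ are finite sets with $0\in B$, $0\in L$, $\#B=\#L=N$; $R^k b\cdot l\in\mathbb{Z}$ for all $b\in B$, $l\in L$ and all integers $k\ge 0$; and the $N\times N$ matrix $\frac{1}{\sqrt N}\left(e^{2\pi i R^{-1}b\cdot l}\right)_{b\in B,\,l\in L}$ is unitary. Measures: for $b\in B$ let $\tau_b(x)=R^{-1}(x+b)$, and for $l\in L$ let $\sigma_l(x)=(R^T)^{-1}(x+l)$, $x\in\mathbb{R}^d$. $\mu_B$ is the unique Borel probability measure on $\mathbb{R}^d$ with $\mu_B=\frac1N\sum_{b\in B}\mu_B\circ\tau_b^{-1}$, and $\mu_L$ is the unique Borel probability measure with $\mu_L=\frac1N\sum_{l\in L}\mu_L\circ\sigma_l^{-1}$. Discrete sets: $\Gamma(B)=\{\sum_{k=0}^n R^k b_k : b_k\in B,\ n\ge 0\}$ and $\Gamma(L)=\{\sum_{k=0}^n (R^T)^k l_k : l_k\in L,\ n\ge 0\}$. Spectral functions, for $t\in\mathbb{R}^d$: $\sigma_{\Gamma(L)}^{(B)}(t)=\sum_{\gamma\in\Gamma(L)}|\widehat{\mu_B}(t+\gamma)|^2$ and $\sigma_{\Gamma(B)}^{(L)}(t)=\sum_{\xi\in\Gamma(B)}|\widehat{\mu_L}(t+\xi)|^2$, where $\widehat{\mu}(t)=\int_{\mathbb{R}^d}e^{2\pi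 i t\cdot x}\,d\mu(x)$. Let $\chi_B(t)=\frac1N\sum_{b\in B}e^{2\pi i b\cdot t}$ and $\chi_L(t)=\frac1N\sum_{l\in L}e^{2\pi i l\cdot t}$. Transfer operators on functions $f$ on $\mathbb{R}^d$: $$(T_Bf)(t)=\sum_{l\in L}|\chi_B(\sigma_l(t))|^2f(\sigma_l(t)),\qquad (T_Lf)(t)=\sum_{b\in B}|\chi_L(\tau_b(t))|^2f(\tau_b(t)).$$ $E_+(T_B)=\{f:\mathbb{R}^d\to[0,1] : f\in C^1,\ T_Bf=f,\ f(0)=1\}$, and $E_+(T_L)$ is defined in the same way with $T_L$ in place of $T_B$. *)

theory Defs
  imports "HOL-Probability.Probability"
begin

(* The eigenvalues of a real matrix are taken over the complex numbers. *)
definition expansive :: "real ^ 'n ^ 'n \<Rightarrow> bool" where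
  "expansive R \<longleftrightarrow>
     (\<forall>(z::complex) (v::complex ^ 'n).
        v \<noteq> 0 \<and> map_matrix complex_of_real R *v v = z *s v \<longrightarrow> norm z > 1)"

(* U U* = I and U* U = I, for a matrix with rows indexed by B and columns indexed by L. *)
definition unitary_on :: "'b set \<Rightarrow> 'l set \<Rightarrow> ('b \<Rightarrow> 'l \<Rightarrow> complex) \<Rightarrow> bool" where
  "unitary_on B L U \<longleftrightarrow>
     (\<forall>b\<in>B. \<forall>b'\<in>B. (\<Sum>l\<in>L. U b l * cnj (U b' l)) = (if b = b' then 1 else 0)) \<and>
     (\<forall>l\<in>L. \<forall>l'\<in>L. (\<Sum>b\<in>B. cnj (U b l) * U b l') = (if l = l' then 1 else 0))"

(* The power R^k acts on vectors as the k-fold iterate of R: the type real ^ 'n ^ 'n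
   carries only the componentwise product, so (^) is not the matrix power. *)
definition hadamard_system ::
    "real ^ 'n ^ 'n \<Rightarrow> (real ^ 'n) set \<Rightarrow> (real ^ 'n) set \<Rightarrow> bool" where
  "hadamard_system R B L \<longleftrightarrow>
     (\<forall>i j. R $ i $ j \<in> \<int>) \<and> expansive R \<and>
     finite B \<and> finite L \<and> 0 \<in> B \<and> 0 \<in> L \<and> card B = card L \<and>
     (\<forall>b\<in>B. \<forall>l\<in>L. \<forall>k::nat. (((\<lambda>v. R *v v) ^^ k) b) \<bullet> l \<in> \<int>) \<and>
     unitary_on B L
       (\<lambda>b l. complex_of_real (1 / sqrt (real (card B))) * cis (2 * pi * ((matrix_inv R *v b) \<bullet> l)))"

(* tau_b is affine_branch R b, and sigma_l is affine_branch (transpose R) l. *)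
definition affine_branch :: "real ^ 'n ^ 'n \<Rightarrow> real ^ 'n \<Rightarrow> real ^ 'n \<Rightarrow> real ^ 'n" where
  "affine_branch S a x = matrix_inv S *v (x + a)"

(* mu_B is ifs_measure R B, and mu_L is ifs_measure (transpose R) L. *)
definition ifs_measure :: "real ^ 'n ^ 'n \<Rightarrow> (real ^ 'n) set \<Rightarrow> (real ^ 'n) measure" where
  "ifs_measure S A =
     (THE M. sets M = sets borel \<and> prob_space M \<and>
        (\<forall>E\<in>sets borel. measure M E =
           1 / real (card A) * (\<Sum>a\<in>A. measure (distr M borel (affine_branch S a)) E)))"

(* Gamma(B) is digit_set R B, and Gamma(L) is digit_set (transpose R) L. *)
definition digit_set :: "real ^ 'n ^ 'n \<Rightarrow> (real ^ 'n) set \<Rightarrow> (real ^ 'n) set" where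
  "digit_set S A = {\<Sum>k\<le>n. ((\<lambda>v. S *v v) ^^ k) (a k) | (n::nat) a. \<forall>k\<le>n. a k \<in> A}"

definition fourier :: "(real ^ 'n) measure \<Rightarrow> real ^ 'n \<Rightarrow> complex" where
  "fourier M t = (LINT x|M. cis (2 * pi * (t \<bullet> x)))"

definition spectral_function :: "(real ^ 'n) measure \<Rightarrow> (real ^ 'n) set \<Rightarrow> real ^ 'n \<Rightarrow> real" where
  "spectral_function M G t = (\<Sum>\<^sub>\<infinity>g\<in>G. (cmod (fourier M (t + g)))\<^sup>2)"

definition mask :: "(real ^ 'n) set \<Rightarrow> real ^ 'n \<Rightarrow> complex" where
  "mask A t = 1 / of_nat (card A) * (\<Sum>a\<in>A. cis (2 * pi * (a \<bullet> t)))"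

(* T_B is transfer_op (transpose R) B L (branches sigma_l, l in L), and
   T_L is transfer_op R L B (branches tau_b, b in B). *)
definition transfer_op ::
    "real ^ 'n ^ 'n \<Rightarrow> (real ^ 'n) set \<Rightarrow> (real ^ 'n) set \<Rightarrow> (real ^ 'n \<Rightarrow> real) \<Rightarrow> real ^ 'n \<Rightarrow> real" where
  "transfer_op S A C f t =
     (\<Sum>c\<in>C. (cmod (mask A (affine_branch S c t)))\<^sup>2 * f (affine_branch S c t))"

definition continuously_differentiable :: "(real ^ 'n \<Rightarrow> real) \<Rightarrow> bool" where
  "continuously_differentiable f \<longleftrightarrow>
     (\<exists>f'. (\<forall>x. (f has_derivative blinfun_apply (f' x)) (at x)) \<and> continuous_on UNIV f')"

definition E_plus :: "((real ^ 'n \<Rightarrow> real) \<Rightarrow> real ^ 'n \<Rightarrow> real) \<Rightarrow> (real ^ 'n \<Rightarrow> real) set" where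
  "E_plus T = {f. range f \<subseteq> {0..1} \<and> continuously_differentiable f \<and> T f = f \<and> f 0 = 1}"

(* The library's convex requires a real_vector type, which real functions are not. *)
definition convex_functions :: "('a \<Rightarrow> real) set \<Rightarrow> bool" where
  "convex_functions E \<longleftrightarrow>
     (\<forall>f\<in>E. \<forall>g\<in>E. \<forall>u\<in>{0..1}. (\<lambda>t. (1 - u) * f t + u * g t) \<in> E)"

(* The interval [lo, hi] in the space of continuously differentiable fixed functions of T,
   ordered pointwise. *)
definition fixed_interval ::
    "((real ^ 'n \<Rightarrow> real) \<Rightarrow> real ^ 'n \<Rightarrow> real) \<Rightarrow> (real ^ 'n \<Rightarrow> real) \<Rightarrow> (real ^ 'n \<Rightarrow> real) \<Rightarrow>
       (real ^ 'n \<Rightarrow> real) set" where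
  "fixed_interval T lo hi =
     {f. continuously_differentiable f \<and> T f = f \<and> (\<forall>t. lo t \<le> f t \<and> f t \<le> hi t)}"

end

theory Submission
  imports Defs "HOL-Computational_Algebra.Fundamental_Theorem_Algebra"
begin

text \<open>Fix one side of the symmetry, put \<open>S = R\<^sup>T\<close>, let \<open>\<mu>\<close> be the invariant measure of \<open>(R, B)\<close>, let
  \<open>g = \<bar>fourier \<mu>\<bar>\<^sup>2\<close>, and let \<open>T\<close> be the transfer operator with branches
  \<open>t \<mapsto> S\<^bsup>-1\<^esup> (t + l)\<close>. Unitarity of the Hadamard matrix says that \<open>T 1 = 1\<close>
  (\<open>mask_branch_sum\<close>). The mask is periodic with respect to the digit sums and digit expansions
  are unique, so \<open>T\<^sup>n f (t)\<close> is the sum, over all \<open>n\<close>-digit sums \<open>\<gamma>\<close>, of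
  \<open>p n (t + \<gamma>) * f (S\<^bsup>-n\<^esup> (t + \<gamma>))\<close>, where \<open>p n\<close> is the product of \<open>n\<close> squared mask values
  (\<open>T_iterate\<close>). The refinement equation \<open>g x = p n x * g (S\<^bsup>-n\<^esup> x)\<close> then identifies
  \<open>T\<^sup>n g\<close> with the \<open>n\<close>-th partial sum of the spectral function \<open>\<sigma>\<close>. These sums are at most
  \<open>T\<^sup>n 1 = 1\<close>, so \<open>\<sigma>\<close> is their limit, \<open>0 \<le> \<sigma> \<le> 1\<close>, \<open>T \<sigma> = \<sigma>\<close>, and \<open>\<sigma> 0 = 1\<close> since
  \<open>g 0 = 1\<close>. If \<open>f\<close> belongs to \<open>E_plus T\<close>, then restricting \<open>f = T\<^sup>n f\<close> to finitely many \<open>\<gamma>\<close> and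
  letting \<open>n\<close> grow gives \<open>\<sigma> \<le> f\<close>, because \<open>p n \<longlonglongrightarrow> g\<close> and \<open>f\<close> is continuous at \<open>0\<close>
  (\<open>sigma_minimal\<close>).

  The remaining point is that \<open>\<sigma>\<close> is continuously differentiable. The bound \<open>\<sigma> \<le> 1\<close> implies that
  the characters with frequencies in \<open>\<Gamma>\<close> are orthonormal in \<open>L\<^sup>2(\<mu>)\<close>, so \<open>\<sigma> t\<close> is the squared length
  of the projection of the character \<open>e t\<close> to their closed span. As \<open>\<mu>\<close> has bounded support,
  \<open>t \<mapsto> e t\<close> has a first order Taylor expansion with quadratic remainder in \<open>L\<^sup>2(\<mu>)\<close>. Bessel's
  inequality turns this into a quadratic remainder estimate for the finite partial sums of \<open>\<sigma>\<close>,
  with a constant that does not depend on the sum (\<open>partial_sum_quadratic_expansion\<close>), and such an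
  estimate survives pointwise limits and yields a Lipschitz derivative (\<open>C1_limit\<close>).

  The measure must be shown to exist uniquely. Expansiveness gives
  \<open>(\<Sum>k. norm (R\<^bsup>-k\<^esup> v)) < \<infinity>\<close> for every \<open>v\<close> (\<open>expansive_summable_orbit\<close>). Hence random digit
  series converge, and their law is an invariant measure of bounded support
  (\<open>self_similar_exists\<close>); it is the only one because compositions of many branches contract
  (\<open>self_similar_unique\<close>).\<close>


section \<open>Orbits under the inverse of an expansive matrix\<close>

text \<open>The vector \<open>p(A) v\<close> for a complex polynomial \<open>p\<close>, by Horner's scheme. Only its action on a
  vector is needed, so no ring structure on square matrices has to be set up.\<close>

definition poly_apply :: "complex ^ 'n ^ 'n \<Rightarrow> complex poly \<Rightarrow> complex ^ 'n \<Rightarrow> complex ^ 'n" where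
  "poly_apply A p v = fold_coeffs (\<lambda>a w. a *s v + A *v w) p 0"

lemma poly_apply_0 [simp]: "poly_apply A 0 v = 0"
  by (simp add: poly_apply_def)

lemma poly_apply_pCons [simp]: "poly_apply A (pCons a p) v = a *s v + A *v poly_apply A p v"
  by (cases "a = 0 \<and> p = 0") (auto simp: poly_apply_def)

lemma poly_apply_add: "poly_apply A (p + q) v = poly_apply A p v + poly_apply A q v"
  by (induction p q rule: poly_induct2)
     (simp_all add: matrix_vector_right_distrib vec.scale_left_distrib algebra_simps)

lemma poly_apply_smult: "poly_apply A (smult c p) v = c *s poly_apply A p v"
  by (induction p) (simp_all add: vec.scale_right_distrib vector_scalar_commute)

lemma poly_apply_sum: "poly_apply A (\<Sum>i\<in>I. p i) v = (\<Sum>i\<in>I. poly_apply A (p i) v)"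
  by (induction I rule: infinite_finite_induct) (auto simp: poly_apply_add)

lemma poly_apply_monom: "poly_apply A (monom c i) v = c *s ((*v) A ^^ i) v"
  by (induction i) (auto simp: monom_0 monom_Suc vector_scalar_commute)

lemma poly_apply_linear_factor:
  "poly_apply A ([:- z, 1:] * q) v = A *v poly_apply A q v - z *s poly_apply A q v"
proof -
  have "[:- z, 1:] * q = smult (- z) q + pCons 0 q" by simp
  then show ?thesis
    by (simp only: poly_apply_add poly_apply_smult poly_apply_pCons) (simp add: vec.scale_minus_left)
qed

lemma poly_apply_commute:
  "A *v poly_apply A q v - z *s poly_apply A q v = poly_apply A q (A *v v - z *s v)"
proof (induction q)
  case (pCons a q)
  show ?case unfolding poly_apply_pCons pCons.IH[symmetric]
    by (simp add: matrix_vector_right_distrib matrix_vector_mult_diff_distrib vec.scale_right_distrib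
        vec.scale_right_diff_distrib vector_scalar_commute algebra_simps)
qed auto

lemma funpow_matrix_add:
  fixes A :: "'a::field ^ 'n ^ 'n"
  shows "((*v) A ^^ k) (v + w) = ((*v) A ^^ k) v + ((*v) A ^^ k) w"
  by (induction k) (simp_all add: matrix_vector_right_distrib)

lemma funpow_matrix_scale:
  fixes A :: "'a::field ^ 'n ^ 'n"
  shows "((*v) A ^^ k) (c *s v) = c *s ((*v) A ^^ k) v"
  by (induction k) (simp_all add: vector_scalar_commute)

text \<open>The vectors \<open>v, A v, A\<^sup>2 v, \<dots>\<close> are linearly dependent over the reals already, since
  \<open>complex ^ 'n\<close> is a finite-dimensional real space.\<close>

lemma exists_annihilating_poly:
  fixes A :: "complex ^ 'n ^ 'n"
  shows "\<exists>p. p \<noteq> 0 \<and> poly_apply A p v = 0"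
proof -
  define g where "g i = ((*v) A ^^ i) v" for i
  define n where "n = DIM(complex ^ 'n)"
  show ?thesis
  proof (cases "inj_on g {..n}")
    case False
    then obtain i j where ij: "g i = g j" "i \<noteq> j" by (auto simp: inj_on_def)
    have "coeff (monom 1 i - monom (1::complex) j) i \<noteq> 0" using ij by simp
    then have "monom 1 i - monom (1::complex) j \<noteq> 0" by (metis coeff_0)
    moreover have "poly_apply A (monom 1 i + smult (-1) (monom 1 j)) v = 0"
      unfolding poly_apply_add poly_apply_smult poly_apply_monom using ij by (simp add: g_def)
    ultimately show ?thesis by (metis diff_conv_add_uminus smult_minus_left smult_1_left)
  next
    case True
    then have "card (g ` {..n}) = Suc n" by (simp add: card_image)
    then have "dependent (g ` {..n})"
      by (intro dependent_biggerset) (auto simp: n_def)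
    then obtain u w where u: "w \<in> g ` {..n}" "u w \<noteq> 0" "(\<Sum>x\<in>g ` {..n}. u x *\<^sub>R x) = 0"
      by (auto simp: dependent_finite)
    from u(1) obtain i where i: "i \<le> n" "w = g i" by auto
    define p where "p = (\<Sum>i\<le>n. monom (complex_of_real (u (g i))) i)"
    have "coeff p i = of_real (u (g i))"
      using i(1) by (simp add: p_def coeff_sum)
    with u(2) i have "p \<noteq> 0" by auto
    moreover have "poly_apply A p v = (\<Sum>i\<le>n. u (g i) *\<^sub>R g i)"
      by (simp only: p_def poly_apply_sum poly_apply_monom g_def)
         (simp add: vec_eq_iff scaleR_conv_of_real[where 'a=complex])
    moreover have "\<dots> = 0"
      using u(3) True by (simp add: sum.reindex)
    ultimately show ?thesis by metis
  qed
qed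

lemma norm_scale_vec: "norm (z *s (v::complex^'n)) = cmod z * norm v"
  by (simp add: norm_vec_def norm_mult L2_set_right_distrib)

lemma summable_linear_recurrence:
  fixes a e :: "nat \<Rightarrow> real"
  assumes "\<And>k. 0 \<le> a k" "\<And>k. 0 \<le> e k" "summable e" "0 \<le> r" "r < 1"
    and rec: "\<And>k. a (Suc k) \<le> r * a k + e k"
  shows "summable a"
proof (rule bounded_imp_summable)
  fix n
  have "(1 - r) * (\<Sum>k\<le>n. a k) \<le> a 0 + (\<Sum>k<n. e k) - r * a n"
  proof (induction n)
    case (Suc n)
    have "(1 - r) * (\<Sum>k\<le>Suc n. a k) \<le> a 0 + (\<Sum>k<n. e k) - r * a n + (1 - r) * a (Suc n)"
      using Suc by (simp add: algebra_simps)
    also have "\<dots> \<le> a 0 + (\<Sum>k<Suc n. e k) - r * a (Suc n)"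
      using rec[of n] by (simp add: algebra_simps)
    finally show ?case .
  qed (use assms(2)[of 0] in \<open>simp add: algebra_simps\<close>)
  also have "\<dots> \<le> a 0 + suminf e"
    using assms sum_le_suminf[OF assms(3), of "{..<n}"] by (auto intro: add_mono order_trans[rotated])
  finally show "(\<Sum>k\<le>n. a k) \<le> (a 0 + suminf e) / (1 - r)"
    using assms by (simp add: field_simps)
qed (use assms in auto)

text \<open>Induction on the degree of \<open>p = (X - z) q\<close>. If \<open>\<bar>z\<bar> \<ge> 1\<close>, then \<open>A - z\<close> is injective and \<open>q\<close>
  already annihilates \<open>v\<close>. If \<open>\<bar>z\<bar> < 1\<close>, then \<open>q\<close> annihilates \<open>u = A v - z v\<close>, whose orbit is
  summable by induction, and the orbit of \<open>v\<close> obeys the recurrence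
  \<open>A\<^bsup>k+1\<^esup> v = z A\<^bsup>k\<^esup> v + A\<^bsup>k\<^esup> u\<close>.\<close>

lemma summable_orbit_poly:
  fixes A :: "complex ^ 'n ^ 'n"
  assumes eig: "\<And>z v. v \<noteq> 0 \<Longrightarrow> A *v v = z *s v \<Longrightarrow> cmod z < 1"
    and "p \<noteq> 0" "poly_apply A p v = 0"
  shows "summable (\<lambda>k. norm (((*v) A ^^ k) v))"
  using assms(2,3)
proof (induction "degree p" arbitrary: p v)
  case 0
  then obtain c where "p = [:c:]" by (metis degree_eq_zeroE)
  with 0 have "v = 0" by (auto simp: vec_eq_iff)
  moreover have "((*v) A ^^ k) 0 = 0" for k by (induction k) auto
  ultimately show ?case by simp
next
  case (Suc d)
  then have "\<not> constant (poly p)" by (metis constant_degree nat.distinct(1))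
  then obtain z where "poly p z = 0" using fundamental_theorem_of_algebra by blast
  then obtain q where q: "p = [:- z, 1:] * q" by (metis poly_eq_0_iff_dvd dvdE)
  from Suc q have q0: "q \<noteq> 0" by auto
  have "degree p = Suc (degree q)" unfolding q by (subst degree_mult_eq) (use q0 in auto)
  with Suc have dq: "d = degree q" by simp
  show ?case
  proof (cases "cmod z < 1")
    case False
    have "A *v poly_apply A q v = z *s poly_apply A q v"
      using Suc.prems(2) unfolding q poly_apply_linear_factor by simp
    with eig False have "poly_apply A q v = 0" by blast
    with Suc.hyps(1)[OF dq q0] show ?thesis by blast
  next
    case True
    define u where "u = A *v v - z *s v"
    have "poly_apply A q u = 0"
      using Suc.prems(2) unfolding q poly_apply_linear_factor poly_apply_commute u_def .
    with Suc.hyps(1)[OF dq q0] have su: "summable (\<lambda>k. norm (((*v) A ^^ k) u))" by blast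
    have Av: "A *v v = z *s v + u" by (simp add: u_def)
    show ?thesis
    proof (rule summable_linear_recurrence[OF _ _ su _ True])
      fix k
      have "((*v) A ^^ Suc k) v = z *s ((*v) A ^^ k) v + ((*v) A ^^ k) u"
        by (simp only: funpow_Suc_right o_def Av funpow_matrix_add funpow_matrix_scale)
      then show "norm (((*v) A ^^ Suc k) v) \<le> cmod z * norm (((*v) A ^^ k) v) + norm (((*v) A ^^ k) u)"
        by (metis norm_triangle_ineq norm_scale_vec)
    qed auto
  qed
qed

text \<open>The entrywise inclusion of real into complex vectors, which carries real orbits to complex ones
  and preserves the norm.\<close>

definition complexify :: "real ^ 'n \<Rightarrow> complex ^ 'n" where
  "complexify v = (\<chi> i. complex_of_real (v $ i))"

lemma complexify_mult: "complexify (A *v v) = map_matrix complex_of_real A *v complexify v"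
  by (simp add: complexify_def matrix_vector_mult_def vec_eq_iff)

lemma norm_complexify: "norm (complexify v) = norm v"
  by (simp add: complexify_def norm_vec_def)

lemma complexify_eq_0: "complexify v = 0 \<longleftrightarrow> v = 0"
  by (simp add: complexify_def vec_eq_iff)

lemma matrix_inv_mult:
  fixes A :: "'a::field ^ 'n ^ 'n"
  assumes "invertible A"
  shows "matrix_inv A ** A = mat 1" "A ** matrix_inv A = mat 1"
  using someI_ex[OF assms[unfolded invertible_def]] by (auto simp: matrix_inv_def)

lemma map_matrix_mult:
  "map_matrix complex_of_real (A ** B) = map_matrix complex_of_real A ** map_matrix complex_of_real B"
  by (simp add: matrix_matrix_mult_def vec_eq_iff)

lemma map_matrix_mat_1: "map_matrix complex_of_real (mat 1) = mat 1"
  by (simp add: mat_def vec_eq_iff)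

lemma expansive_imp_invertible:
  assumes "expansive R"
  shows "invertible R"
proof -
  have "x = 0" if "R *v x = 0" for x
  proof (rule ccontr)
    assume "x \<noteq> 0"
    moreover have "map_matrix complex_of_real R *v complexify x = 0 *s complexify x"
      using that by (simp flip: complexify_mult) (simp add: complexify_def vec_eq_iff)
    ultimately have "norm (0::complex) > 1"
      using assms complexify_eq_0[of x] unfolding expansive_def by blast
    then show False by simp
  qed
  then show ?thesis
    by (simp add: invertible_left_inverse matrix_left_invertible_ker)
qed

text \<open>The eigenvalues of the inverse of an expansive matrix are the inverses of its eigenvalues,
  hence lie in the open unit disc.\<close>

lemma expansive_summable_orbit:
  fixes R :: "real ^ 'n ^ 'n"
  assumes "expansive R"
  shows "summable (\<lambda>k. norm (((*v) (matrix_inv R) ^^ k) v))"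
proof -
  let ?C = "map_matrix complex_of_real R" and ?D = "map_matrix complex_of_real (matrix_inv R)"
  have CD: "?C ** ?D = mat 1"
    by (simp add: matrix_inv_mult[OF expansive_imp_invertible[OF assms]] map_matrix_mat_1
        flip: map_matrix_mult)
  have "cmod z < 1" if "w \<noteq> 0" "?D *v w = z *s w" for z w
  proof -
    have w: "w = z *s (?C *v w)"
      by (metis CD matrix_vector_mul_assoc matrix_vector_mul_lid that(2) vector_scalar_commute)
    then have z: "z \<noteq> 0" using that(1) by auto
    have "?C *v w = (1 / z) *s w"
      by (subst (2) w) (use z in \<open>simp add: vec_eq_iff\<close>)
    then have "norm (1 / z) > 1" using assms that(1) unfolding expansive_def by blast
    then show ?thesis using z by (simp add: norm_divide field_simps)
  qed
  then have "summable (\<lambda>k. norm (((*v) ?D ^^ k) (complexify v)))"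
    using exists_annihilating_poly[of ?D "complexify v"] summable_orbit_poly[of ?D] by blast
  moreover have "((*v) ?D ^^ k) (complexify v) = complexify (((*v) (matrix_inv R) ^^ k) v)" for k
    by (induction k) (auto simp: complexify_mult)
  ultimately show ?thesis by (simp add: norm_complexify)
qed

section \<open>Self-similar measures\<close>

text \<open>The defining property of the invariant measure of the iterated function system with the
  branches \<open>affine_branch S a\<close> for \<open>a\<close> in \<open>D\<close>, all with the same weight.\<close>

definition self_similar :: "real ^ 'n ^ 'n \<Rightarrow> (real ^ 'n) set \<Rightarrow> (real ^ 'n) measure \<Rightarrow> bool" where
  "self_similar S D M \<longleftrightarrow> sets M = sets borel \<and> prob_space M \<and>
     (\<forall>E\<in>sets borel. measure M E =
        1 / real (card D) * (\<Sum>a\<in>D. measure (distr M borel (affine_branch S a)) E))"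

lemma continuous_on_affine_branch [continuous_intros]:
  "continuous_on X f \<Longrightarrow> continuous_on X g \<Longrightarrow> continuous_on X (\<lambda>x. affine_branch S (f x) (g x))"
  unfolding affine_branch_def
  by (intro bounded_linear.continuous_on[OF matrix_vector_mul_bounded_linear] continuous_on_add)

lemma affine_branch_measurable [measurable]: "affine_branch S a \<in> borel \<rightarrow>\<^sub>M borel"
  by (intro borel_measurable_continuous_onI continuous_intros)

lemma affine_branch_diff:
  "affine_branch S a x - affine_branch S a y = matrix_inv S *v (x - y)"
  by (simp add: affine_branch_def matrix_vector_mult_diff_distrib[symmetric])

text \<open>The digit is drawn from a discrete probability space, whose sigma-algebra is the full power
  set; joint measurability follows from joint continuity of the branches.\<close>

lemma measurable_pair_affine_branch:
  fixes p :: "(real ^ 'n) pmf"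
  assumes [measurable_cong]: "sets M = sets borel"
  shows "(\<lambda>(a, x). affine_branch S a x) \<in> measure_pmf p \<Otimes>\<^sub>M M \<rightarrow>\<^sub>M borel"
proof -
  have 1: "fst \<in> measure_pmf p \<Otimes>\<^sub>M M \<rightarrow>\<^sub>M borel"
    by (rule measurable_compose[OF measurable_fst]) simp
  have 2: "snd \<in> measure_pmf p \<Otimes>\<^sub>M M \<rightarrow>\<^sub>M borel"
    by measurable
  have "continuous_on UNIV (\<lambda>z. affine_branch S (fst z) (snd z))"
    by (intro continuous_intros)
  from borel_measurable_continuous_Pair[OF 1 2 this] show ?thesis
    by (simp add: case_prod_beta)
qed

lemma integral_random_branch:
  fixes f :: "real ^ 'n \<Rightarrow> 'b::{banach,second_countable_topology}"
  assumes M: "sets M = sets borel" "prob_space M" and D: "finite D" "D \<noteq> {}"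
    and f [measurable]: "f \<in> borel_measurable borel" and K: "\<And>x. norm (f x) \<le> K"
  shows "integral\<^sup>L (distr (measure_pmf (pmf_of_set D) \<Otimes>\<^sub>M M) borel (\<lambda>(a, x). affine_branch S a x)) f
    = (1 / real (card D)) *\<^sub>R (\<Sum>a\<in>D. integral\<^sup>L M (\<lambda>x. f (affine_branch S a x)))"
proof -
  interpret M: prob_space M by fact
  interpret P: pair_prob_space "measure_pmf (pmf_of_set D)" M ..
  note [measurable] = measurable_pair_affine_branch[OF M(1)]
  note [measurable_cong] = M(1)
  have fg: "(\<lambda>z. f (case z of (a, x) \<Rightarrow> affine_branch S a x)) \<in>
      borel_measurable (measure_pmf (pmf_of_set D) \<Otimes>\<^sub>M M)" by measurable
  have int: "integrable (measure_pmf (pmf_of_set D) \<Otimes>\<^sub>M M) (\<lambda>z. f (case z of (a, x) \<Rightarrow> affine_branch S a x))"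
    by (rule P.integrable_const_bound[OF _ fg, of K]) (simp add: K)
  have "integral\<^sup>L (distr (measure_pmf (pmf_of_set D) \<Otimes>\<^sub>M M) borel (\<lambda>(a, x). affine_branch S a x)) f
      = integral\<^sup>L (measure_pmf (pmf_of_set D) \<Otimes>\<^sub>M M) (\<lambda>z. f (case z of (a, x) \<Rightarrow> affine_branch S a x))"
    by (intro integral_distr) auto
  also have "\<dots> = (\<integral>a. (\<integral>x. f (affine_branch S a x) \<partial>M) \<partial>measure_pmf (pmf_of_set D))"
    using P.integral_fst'[OF int] by simp
  also have "\<dots> = (\<Sum>a\<in>D. pmf (pmf_of_set D) a *\<^sub>R (\<integral>x. f (affine_branch S a x) \<partial>M))"
    using D by (intro integral_measure_pmf) (auto simp: set_pmf_of_set)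
  also have "\<dots> = (1 / real (card D)) *\<^sub>R (\<Sum>a\<in>D. integral\<^sup>L M (\<lambda>x. f (affine_branch S a x)))"
    using D by (simp add: pmf_of_set scaleR_sum_right)
  finally show ?thesis .
qed

text \<open>A self-similar measure is the law of a uniformly random branch applied to an independent
  point with that same law; Fubini's theorem then extends the invariance from sets to bounded
  functions.\<close>

lemma self_similar_integral:
  fixes f :: "real ^ 'n \<Rightarrow> 'b::{banach,second_countable_topology}"
  assumes ss: "self_similar S D M" and D: "finite D" "D \<noteq> {}"
    and f: "f \<in> borel_measurable borel" and K: "\<And>x. norm (f x) \<le> K"
  shows "integral\<^sup>L M f = (1 / real (card D)) *\<^sub>R (\<Sum>a\<in>D. integral\<^sup>L M (\<lambda>x. f (affine_branch S a x)))"
proof -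
  have M: "sets M = sets borel" "prob_space M" using ss by (auto simp: self_similar_def)
  interpret M: prob_space M by fact
  interpret P: pair_prob_space "measure_pmf (pmf_of_set D)" M ..
  let ?Q = "distr (measure_pmf (pmf_of_set D) \<Otimes>\<^sub>M M) borel (\<lambda>(a, x). affine_branch S a x)"
  interpret Q: prob_space ?Q
    by (intro P.prob_space_distr measurable_pair_affine_branch M)
  have [measurable]: "affine_branch S a \<in> M \<rightarrow>\<^sub>M borel" for a
    using M(1) affine_branch_measurable measurable_cong_sets by blast
  have "M = ?Q"
  proof (rule measure_eqI)
    fix E assume "E \<in> sets M"
    then have E [measurable]: "E \<in> sets borel" using M by simp
    have "measure ?Q E = integral\<^sup>L ?Q (indicator E)" by simp
    also have "\<dots> = (1 / real (card D)) *\<^sub>R (\<Sum>a\<in>D. integral\<^sup>L M (\<lambda>x. indicator E (affine_branch S a x)))"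
      by (rule integral_random_branch[OF M D, where K=1]) (auto simp: indicator_def)
    also have "\<dots> = 1 / real (card D) * (\<Sum>a\<in>D. measure (distr M borel (affine_branch S a)) E)"
    proof -
      have "integral\<^sup>L M (\<lambda>x. indicator E (affine_branch S a x)) = measure (distr M borel (affine_branch S a)) E" for a
      proof -
        have "integral\<^sup>L M (\<lambda>x. indicator E (affine_branch S a x)) = integral\<^sup>L (distr M borel (affine_branch S a)) (indicator E :: _ \<Rightarrow> real)"
          by (rule integral_distr[symmetric]) auto
        then show ?thesis by simp
      qed
      then show ?thesis by simp
    qed
    also have "\<dots> = measure M E" using ss E by (auto simp: self_similar_def)
    finally show "emeasure M E = emeasure ?Q E"
      by (simp add: M.emeasure_eq_measure Q.emeasure_eq_measure)
  qed (simp add: M)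
  then show ?thesis using integral_random_branch[OF M D f K, of S] by simp
qed

text \<open>\<open>U\<close> averages a function over the branches and preserves the integral. The iterates \<open>U\<^sup>n f\<close>
  of a Lipschitz function become constant in the limit, because \<open>n\<close>-fold branches contract. The
  limit of \<open>(U\<^sup>n f)(0)\<close> does not involve the measure, which gives uniqueness.\<close>

lemma self_similar_integral_lipschitz:
  fixes f :: "real ^ 'n \<Rightarrow> real"
  assumes ss: "self_similar S D M" and D: "finite D" "D \<noteq> {}"
    and decay: "\<And>v. (\<lambda>k. ((*v) (matrix_inv S) ^^ k) v) \<longlonglongrightarrow> 0"
    and f: "\<And>x. \<bar>f x\<bar> \<le> K" "\<And>x y. \<bar>f x - f y\<bar> \<le> c * norm (x - y)"
  defines "U \<equiv> (\<lambda>h x. 1 / real (card D) * (\<Sum>a\<in>D. h (affine_branch S a x)))"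
  shows "(\<lambda>n. (U ^^ n) f 0) \<longlonglongrightarrow> integral\<^sup>L M f"
proof -
  have M [measurable_cong]: "sets M = sets borel" and "prob_space M" using ss by (auto simp: self_similar_def)
  interpret M: prob_space M by fact
  have N: "card D > 0" using D by (simp add: card_gt_0_iff)
  have "continuous_on UNIV f"
  proof (rule lipschitz_on_continuous_on)
    have "0 \<le> c * norm (1 :: real^'n)" using f(2)[of 1 0] by simp
    then have "0 \<le> c" by (simp add: zero_le_mult_iff)
    then show "c-lipschitz_on UNIV f"
      using f(2) by (auto simp: lipschitz_on_def dist_norm)
  qed
  then have f_meas: "f \<in> borel_measurable borel" by (rule borel_measurable_continuous_onI)
  have avg: "\<bar>1 / real (card D) * (\<Sum>a\<in>D. h a)\<bar> \<le> C" if "\<And>a. a \<in> D \<Longrightarrow> \<bar>h a\<bar> \<le> C" for h C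
  proof -
    have "\<bar>\<Sum>a\<in>D. h a\<bar> \<le> real (card D) * C"
      using sum_bounded_above[of D "\<lambda>a. \<bar>h a\<bar>" C] that by (intro order_trans[OF sum_abs]) auto
    then show ?thesis using N by (simp add: abs_mult field_simps)
  qed
  have U: "(U ^^ n) f \<in> borel_measurable borel \<and> (\<forall>x. \<bar>(U ^^ n) f x\<bar> \<le> K) \<and>
      (\<forall>x y. \<bar>(U ^^ n) f x - (U ^^ n) f y\<bar> \<le> c * norm (((*v) (matrix_inv S) ^^ n) (x - y))) \<and>
      integral\<^sup>L M ((U ^^ n) f) = integral\<^sup>L M f" for n
  proof (induction n)
    case (Suc n)
    define h where "h = (U ^^ n) f"
    have h [measurable]: "h \<in> borel_measurable borel" and hK: "\<And>x. \<bar>h x\<bar> \<le> K"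
      and hL: "\<And>x y. \<bar>h x - h y\<bar> \<le> c * norm (((*v) (matrix_inv S) ^^ n) (x - y))"
      and hi: "integral\<^sup>L M h = integral\<^sup>L M f"
      using Suc by (auto simp: h_def)
    have "U h \<in> borel_measurable borel" unfolding U_def by measurable
    moreover have "\<bar>U h x\<bar> \<le> K" for x unfolding U_def by (intro avg hK)
    moreover have "\<bar>U h x - U h y\<bar> \<le> c * norm (((*v) (matrix_inv S) ^^ Suc n) (x - y))" for x y
    proof -
      have "\<bar>h (affine_branch S a x) - h (affine_branch S a y)\<bar> \<le> c * norm (((*v) (matrix_inv S) ^^ Suc n) (x - y))" for a
        using hL[of "affine_branch S a x" "affine_branch S a y"]
        by (simp add: affine_branch_diff funpow_swap1)
      then have "\<bar>1 / real (card D) * (\<Sum>a\<in>D. h (affine_branch S a x) - h (affine_branch S a y))\<bar>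
        \<le> c * norm (((*v) (matrix_inv S) ^^ Suc n) (x - y))" by (intro avg)
      then show ?thesis by (simp add: U_def sum_subtractf diff_divide_distrib)
    qed
    moreover have "integral\<^sup>L M (U h) = integral\<^sup>L M h"
    proof -
      have "integrable M (\<lambda>x. h (affine_branch S a x))" for a
        by (rule M.integrable_const_bound[of _ K]) (use hK in auto)
      then have "integral\<^sup>L M (U h) = 1 / real (card D) * (\<Sum>a\<in>D. integral\<^sup>L M (\<lambda>x. h (affine_branch S a x)))"
        by (simp add: U_def integral_sum)
      also have "\<dots> = integral\<^sup>L M h"
        using self_similar_integral[OF ss D h, of K] hK by simp
      finally show ?thesis .
    qed
    ultimately show ?case by (simp add: h_def[symmetric] hi)
  qed (use f f_meas in auto)
  have [measurable]: "(U ^^ n) f \<in> borel_measurable borel" for n using U by blast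
  have "(\<lambda>n. \<integral>x. (U ^^ n) f x - (U ^^ n) f 0 \<partial>M) \<longlonglongrightarrow> (\<integral>x. 0 \<partial>M)"
  proof (rule integral_dominated_convergence[where w="\<lambda>_. K + K"])
    show "AE x in M. (\<lambda>n. (U ^^ n) f x - (U ^^ n) f 0) \<longlonglongrightarrow> 0"
    proof (rule AE_I2)
      fix x
      have lim: "(\<lambda>n. c * norm (((*v) (matrix_inv S) ^^ n) (x - 0))) \<longlonglongrightarrow> 0"
        by (rule tendsto_eq_rhs[OF tendsto_mult[OF tendsto_const tendsto_norm[OF decay]]]) simp
      have le: "norm ((U ^^ n) f x - (U ^^ n) f 0) \<le> c * norm (((*v) (matrix_inv S) ^^ n) (x - 0))" for n
        using U[of n] unfolding real_norm_def by blast
      show "(\<lambda>n. (U ^^ n) f x - (U ^^ n) f 0) \<longlonglongrightarrow> 0"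
        by (rule Lim_null_comparison[OF _ lim]) (intro always_eventually allI le)
    qed
    show "AE x in M. norm ((U ^^ n) f x - (U ^^ n) f 0) \<le> K + K" for n
    proof (rule AE_I2)
      fix x show "norm ((U ^^ n) f x - (U ^^ n) f 0) \<le> K + K"
        using U[of n] unfolding real_norm_def by (intro order_trans[OF abs_triangle_ineq4] add_mono) blast+
    qed
  qed (auto)
  moreover have "(\<integral>x. (U ^^ n) f x - (U ^^ n) f 0 \<partial>M) = integral\<^sup>L M f - (U ^^ n) f 0" for n
  proof -
    have "integrable M ((U ^^ n) f)"
      by (rule M.integrable_const_bound[of _ K]) (use U in auto)
    then show ?thesis using U[of n] by (simp add: M.prob_space)
  qed
  ultimately have "(\<lambda>n. integral\<^sup>L M f - (integral\<^sup>L M f - (U ^^ n) f 0)) \<longlonglongrightarrow> integral\<^sup>L M f - 0"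
    by (intro tendsto_diff tendsto_const) simp
  then show ?thesis by simp
qed

text \<open>The indicator of a closed set \<open>F\<close> is the limit of the Lipschitz functions
  \<open>max 0 (1 - n d(x, F))\<close>.\<close>

lemma prob_measure_eqI_lipschitz:
  fixes M M' :: "'a::metric_space measure"
  assumes M: "sets M = sets borel" "prob_space M" and M': "sets M' = sets borel" "prob_space M'"
    and eq: "\<And>f c. (\<And>x. 0 \<le> f x \<and> f x \<le> (1::real)) \<Longrightarrow> (\<And>x y. \<bar>f x - f y\<bar> \<le> c * dist x y) \<Longrightarrow>
      integral\<^sup>L M f = integral\<^sup>L M' f"
  shows "M = M'"
proof -
  have lim: "(\<lambda>n. \<integral>x. max 0 (1 - real n * infdist x F) \<partial>N) \<longlonglongrightarrow> measure N F"
    if F: "closed F" "F \<noteq> {}" and N: "sets N = sets borel" "prob_space N" for F and N :: "'a measure"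
  proof -
    interpret prob_space N by fact
    note [measurable_cong] = N(1)
    have [measurable]: "F \<in> sets borel" using F by simp
    have [measurable]: "(\<lambda>x. infdist x F) \<in> borel_measurable borel"
      by (intro borel_measurable_continuous_onI continuous_intros)
    have "(\<lambda>n. \<integral>x. max 0 (1 - real n * infdist x F) \<partial>N) \<longlonglongrightarrow> integral\<^sup>L N (indicator F)"
    proof (rule integral_dominated_convergence[where w="\<lambda>_. 1"])
      show "AE x in N. (\<lambda>n. max 0 (1 - real n * infdist x F)) \<longlonglongrightarrow> indicator F x"
      proof (rule AE_I2)
        fix x
        show "(\<lambda>n. max 0 (1 - real n * infdist x F)) \<longlonglongrightarrow> indicator F x"
        proof (cases "x \<in> F")
          case False
          then have d: "infdist x F > 0" using F
            by (metis in_closed_iff_infdist_zero infdist_nonneg less_eq_real_def)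
          have "\<forall>\<^sub>F n in sequentially. max 0 (1 - real n * infdist x F) = 0"
            using eventually_ge_at_top[of "nat \<lceil>1 / infdist x F\<rceil>"]
          proof eventually_elim
            case (elim n)
            then have "1 / infdist x F \<le> real n" by linarith
            then show ?case using d by (simp add: field_simps)
          qed
          then show ?thesis using False by (simp add: tendsto_eventually)
        qed simp
      qed
    qed (auto simp: infdist_nonneg)
    then show ?thesis using N sets_eq_imp_space_eq[OF N(1)] by simp
  qed
  interpret M: prob_space M by fact
  interpret M': prob_space M' by fact
  have closed_eq: "emeasure M F = emeasure M' F" if "closed F" for F
  proof (cases "F = {}")
    case False
    have "integral\<^sup>L M (\<lambda>x. max 0 (1 - real n * infdist x F)) = integral\<^sup>L M' (\<lambda>x. max 0 (1 - real n * infdist x F))" for n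
    proof (rule eq[where c="real n"])
      fix x y
      have "\<bar>real n * infdist x F - real n * infdist y F\<bar> \<le> real n * dist x y"
        by (simp add: infdist_triangle_abs mult_left_mono flip: right_diff_distrib abs_mult_pos')
      then show "\<bar>max 0 (1 - real n * infdist x F) - max 0 (1 - real n * infdist y F)\<bar> \<le> real n * dist x y"
        by linarith
    qed (auto simp: infdist_nonneg)
    then have "measure M F = measure M' F"
      using LIMSEQ_unique lim[OF that False M] lim[OF that False M'] by simp
    then show ?thesis by (simp add: M.emeasure_eq_measure M'.emeasure_eq_measure)
  qed simp
  have borel: "sets (borel :: 'a measure) = sigma_sets UNIV (Collect closed)"
    by (subst borel_eq_closed) simp
  show ?thesis
  proof (rule measure_eqI_generator_eq[of "Collect closed" UNIV _ _ "\<lambda>_. UNIV"])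
    show "Int_stable (Collect closed :: 'a set set)" by (simp add: Int_stable_def closed_Int)
    show "sets M = sigma_sets UNIV (Collect closed)" "sets M' = sigma_sets UNIV (Collect closed)"
      using M(1) M'(1) borel by simp_all
    show "emeasure M X = emeasure M' X" if "X \<in> Collect closed" for X using closed_eq that by simp
  qed auto
qed

lemma self_similar_unique:
  assumes "self_similar S D M" "self_similar S D M'" "finite D" "D \<noteq> {}"
    and "\<And>v. (\<lambda>k. ((*v) (matrix_inv S) ^^ k) v) \<longlonglongrightarrow> 0"
  shows "M = M'"
proof (rule prob_measure_eqI_lipschitz)
  fix f :: "real ^ 'a \<Rightarrow> real" and c
  assume f: "\<And>x. 0 \<le> f x \<and> f x \<le> 1" "\<And>x y. \<bar>f x - f y\<bar> \<le> c * dist x y"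
  have f': "\<bar>f x\<bar> \<le> 1" "\<bar>f x - f y\<bar> \<le> c * norm (x - y)" for x y
    using f by (auto simp: dist_norm abs_le_iff intro: order_trans[of _ 0])
  show "integral\<^sup>L M f = integral\<^sup>L M' f"
    by (rule LIMSEQ_unique[OF self_similar_integral_lipschitz[OF assms(1,3-5) f']
      self_similar_integral_lipschitz[OF assms(2,3-5) f']])
qed (use assms(1,2) in \<open>auto simp: self_similar_def\<close>)

text \<open>The measure is the law of the random series \<open>\<Sum>k. S\<^bsup>-(k+1)\<^esup> a\<^sub>k\<close> with independent uniform
  digits \<open>a\<^sub>k\<close>: prepending a digit to the stream applies the corresponding branch to the sum.\<close>

lemma self_similar_exists:
  fixes S :: "real ^ 'n ^ 'n"
  assumes D: "finite D" "D \<noteq> {}"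
    and sum: "\<And>v. summable (\<lambda>k. norm (((*v) (matrix_inv S) ^^ k) v))"
  shows "\<exists>M K. self_similar S D M \<and> (AE x in M. norm x \<le> K)"
proof -
  define A where "A = (*v) (matrix_inv S)"
  \<comment> \<open>Digits outside \<open>D\<close>, which have probability zero, are replaced by \<open>0\<close>, so that the series
    converges for every stream and not only almost surely.\<close>
  define d where "d a = (if a \<in> D then a else 0)" for a
  let ?P = "measure_pmf (pmf_of_set D)"
  let ?W = "stream_space ?P"
  define X where "X \<omega> = (\<Sum>k. (A ^^ Suc k) (d (\<omega> !! k)))" for \<omega>
  interpret W: prob_space ?W by (rule prob_space.prob_space_stream_space[OF measure_pmf.prob_space_axioms])
  define e where "e k = (\<Sum>a\<in>D. norm ((A ^^ Suc k) a))" for k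
  have A0: "(A ^^ k) 0 = 0" for k by (induction k) (auto simp: A_def)
  have se: "summable e"
    unfolding e_def A_def by (intro summable_sum summable_Suc_iff[THEN iffD2] sum)
  have le: "norm ((A ^^ Suc k) (d a)) \<le> e k" for k a
    using D member_le_sum[of a D "\<lambda>a. norm ((A ^^ Suc k) a)"] A0[of "Suc k"]
    by (auto simp: d_def e_def sum_nonneg simp del: funpow.simps)
  have sX: "summable (\<lambda>k. (A ^^ Suc k) (d (\<omega> !! k)))" for \<omega>
    by (rule summable_comparison_test'[OF se]) (rule le)
  have XK: "norm (X \<omega>) \<le> suminf e" for \<omega>
    unfolding X_def by (rule norm_suminf_le[OF le se])
  have X_Stream: "X (a ## \<omega>) = A (d a + X \<omega>)" for a \<omega>
  proof -
    have bl: "bounded_linear A" unfolding A_def by (rule matrix_vector_mul_bounded_linear)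
    have "X (a ## \<omega>) = A (d a) + (\<Sum>k. (A ^^ Suc (Suc k)) (d (\<omega> !! k)))"
      unfolding X_def using suminf_split_head[OF sX[of "a ## \<omega>"]] by simp
    also have "(\<Sum>k. (A ^^ Suc (Suc k)) (d (\<omega> !! k))) = A (X \<omega>)"
      unfolding X_def using bounded_linear.suminf[OF bl sX[of \<omega>]] by simp
    finally show ?thesis by (simp add: A_def matrix_vector_right_distrib)
  qed
  have [measurable]: "X \<in> ?W \<rightarrow>\<^sub>M borel"
  proof -
    have "(\<lambda>\<omega>. (A ^^ Suc k) (d (\<omega> !! k))) \<in> ?W \<rightarrow>\<^sub>M borel" for k
      by (rule measurable_compose[OF measurable_snth]) simp
    then show ?thesis unfolding X_def by measurable
  qed
  define M where "M = distr ?W borel X"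
  have spW: "space ?W = UNIV" by (simp add: space_stream_space)
  have "self_similar S D M"
    unfolding self_similar_def
  proof (intro conjI ballI)
    show "sets M = sets borel" by (simp add: M_def)
    show "prob_space M" unfolding M_def by (rule W.prob_space_distr) simp
    fix E :: "(real ^ 'n) set" assume [measurable]: "E \<in> sets borel"
    have "measure M E = \<P>(\<omega> in ?W. X \<omega> \<in> E)"
      by (simp add: M_def measure_distr spW vimage_def)
    also have "\<dots> = (\<integral>a. \<P>(\<omega> in ?W. X (a ## \<omega>) \<in> E) \<partial>?P)"
    proof -
      have "ennreal \<P>(\<omega> in ?W. X \<omega> \<in> E) = (\<integral>\<^sup>+a. ennreal \<P>(\<omega> in ?W. X (a ## \<omega>) \<in> E) \<partial>?P)"
        by (rule prob_space.prob_stream_space[OF measure_pmf.prob_space_axioms]) measurable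
      also have "\<dots> = ennreal (\<integral>a. \<P>(\<omega> in ?W. X (a ## \<omega>) \<in> E) \<partial>?P)"
        by (intro nn_integral_eq_integral measure_pmf.integrable_const_bound[where B=1]) auto
      finally show ?thesis by (simp add: integral_nonneg_AE)
    qed
    also have "\<dots> = 1 / real (card D) * (\<Sum>a\<in>D. \<P>(\<omega> in ?W. X (a ## \<omega>) \<in> E))"
      using D by (simp add: integral_pmf_of_set)
    also have "(\<Sum>a\<in>D. \<P>(\<omega> in ?W. X (a ## \<omega>) \<in> E)) = (\<Sum>a\<in>D. measure (distr M borel (affine_branch S a)) E)"
    proof (rule sum.cong)
      fix a assume "a \<in> D"
      then have "X (a ## \<omega>) = affine_branch S a (X \<omega>)" for \<omega>
        by (simp add: X_Stream d_def affine_branch_def A_def add.commute)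
      then show "\<P>(\<omega> in ?W. X (a ## \<omega>) \<in> E) = measure (distr M borel (affine_branch S a)) E"
        by (simp add: M_def distr_distr measure_distr spW vimage_def)
    qed simp
    finally show "measure M E = 1 / real (card D) * (\<Sum>a\<in>D. measure (distr M borel (affine_branch S a)) E)" .
  qed
  moreover have "AE x in M. norm x \<le> suminf e"
    unfolding M_def by (subst AE_distr_iff) (use XK in auto)
  ultimately show ?thesis by blast
qed

lemma ifs_measure_properties:
  fixes S :: "real ^ 'n ^ 'n"
  assumes D: "finite D" "D \<noteq> {}"
    and sum: "\<And>v. summable (\<lambda>k. norm (((*v) (matrix_inv S) ^^ k) v))"
  shows "self_similar S D (ifs_measure S D)" "\<exists>K. AE x in ifs_measure S D. norm x \<le> K"
proof -
  obtain M K where M: "self_similar S D M" "AE x in M. norm x \<le> K"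
    using self_similar_exists[OF assms] by blast
  have "(\<lambda>k. ((*v) (matrix_inv S) ^^ k) v) \<longlonglongrightarrow> 0" for v
    using summable_LIMSEQ_zero[OF sum[of v]] by (simp add: tendsto_norm_zero_iff)
  then have "M' = M" if "self_similar S D M'" for M'
    using self_similar_unique[OF that M(1) D] by blast
  then have "ifs_measure S D = M"
    unfolding ifs_measure_def self_similar_def[symmetric] using M(1) by blast
  with M show "self_similar S D (ifs_measure S D)" "\<exists>K. AE x in ifs_measure S D. norm x \<le> K" by auto
qed

section \<open>Fourier transform and Bessel inequality\<close>

lemma matrix_inv_transpose:
  fixes R :: "real ^ 'n ^ 'n"
  assumes "invertible R"
  shows "matrix_inv (transpose R) = transpose (matrix_inv R)"
proof -
  have "transpose R ** transpose (matrix_inv R) = mat 1"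
    by (simp add: matrix_inv_mult(1)[OF assms] transpose_mat flip: matrix_transpose_mul)
  moreover from this have "matrix_inv (transpose R) ** transpose R = mat 1"
    by (intro matrix_inv_mult(1)) (auto simp: invertible_right_inverse)
  ultimately show ?thesis
    by (metis matrix_mul_assoc matrix_mul_lid matrix_mul_rid)
qed

lemma inner_transpose: "(transpose A *v x) \<bullet> y = x \<bullet> (A *v (y :: real ^ 'n))"
  by (metis dot_lmul_matrix transpose_matrix_vector)

lemma borel_measurable_cis [measurable]: "cis \<in> borel_measurable borel"
  by (intro borel_measurable_continuous_onI continuous_intros)

lemma borel_measurable_cnj [measurable]: "cnj \<in> borel_measurable borel"
  by (intro borel_measurable_continuous_onI continuous_intros)

text \<open>The Fourier transform of the invariance relation; \<open>t \<bullet> R\<^bsup>-1\<^esup> x = (R\<^sup>T)\<^bsup>-1\<^esup> t \<bullet> x\<close> moves the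
  matrix to the frequency side.\<close>

lemma fourier_refinement:
  fixes R :: "real ^ 'n ^ 'n"
  assumes ss: "self_similar R B M" and B: "finite B" "B \<noteq> {}" and R: "invertible R"
  shows "fourier M t = mask B (matrix_inv (transpose R) *v t) * fourier M (matrix_inv (transpose R) *v t)"
proof -
  let ?s = "matrix_inv (transpose R) *v t"
  have s: "?s \<bullet> x = t \<bullet> (matrix_inv R *v x)" for x
    by (simp only: matrix_inv_transpose[OF R] inner_transpose)
  have "fourier M t = (1 / real (card B)) *\<^sub>R (\<Sum>b\<in>B. LINT x|M. cis (2 * pi * (t \<bullet> affine_branch R b x)))"
    unfolding fourier_def by (rule self_similar_integral[OF ss B, where K=1]) auto
  also have "\<dots> = (1 / real (card B)) *\<^sub>R (\<Sum>b\<in>B. cis (2 * pi * (b \<bullet> ?s)) * fourier M ?s)"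
  proof -
    have "cis (2 * pi * (t \<bullet> affine_branch R b x)) = cis (2 * pi * (b \<bullet> ?s)) * cis (2 * pi * (?s \<bullet> x))" for b x
      unfolding inner_commute[of b] s cis_mult
      by (simp add: affine_branch_def matrix_vector_right_distrib inner_add_right algebra_simps)
    then show ?thesis by (simp add: fourier_def)
  qed
  also have "\<dots> = mask B ?s * fourier M ?s"
    by (simp add: mask_def scaleR_conv_of_real sum_distrib_right)
  finally show ?thesis .
qed

text \<open>A probability measure on the Borel sets of Euclidean space.\<close>

locale borel_prob = prob_space M for M :: "(real ^ 'n) measure" +
  assumes sets_M [simp, measurable_cong]: "sets M = sets borel"
begin

text \<open>The character of frequency \<open>t\<close>.\<close>

definition e :: "real ^ 'n \<Rightarrow> real ^ 'n \<Rightarrow> complex" where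
  "e t x = cis (2 * pi * (t \<bullet> x))"

lemma fourier_e: "fourier M t = (LINT x|M. e t x)"
  by (simp add: fourier_def e_def)

lemma e_meas [measurable]: "e t \<in> borel_measurable M"
  unfolding e_def by measurable

lemma norm_e [simp]: "norm (e t x) = 1"
  by (simp add: e_def)

lemma e_add: "e (s + t) x = e s x * e t x"
  by (simp add: e_def cis_mult inner_add_left algebra_simps)

lemma e_cnj: "cnj (e t x) = e (- t) x"
  by (simp add: e_def cis_cnj)

lemma fourier_0: "fourier M 0 = 1"
  by (simp add: fourier_def prob_space)

lemma norm_fourier_le: "cmod (fourier M t) \<le> 1"
  unfolding fourier_e by (rule order_trans[OF integral_norm_bound]) (simp add: prob_space)

lemma tendsto_fourier:
  assumes "X \<longlonglongrightarrow> 0"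
  shows "(\<lambda>n. fourier M (X n)) \<longlonglongrightarrow> 1"
proof -
  have "(\<lambda>n. fourier M (X n)) \<longlonglongrightarrow> fourier M 0"
    unfolding fourier_e
  proof (rule integral_dominated_convergence[where w="\<lambda>_. 1"])
    show "AE x in M. (\<lambda>n. e (X n) x) \<longlonglongrightarrow> e 0 x"
      unfolding e_def by (intro AE_I2 isCont_tendsto_compose[where g=cis] continuous_intros tendsto_intros assms)
  qed auto
  then show ?thesis by (simp add: fourier_0)
qed

text \<open>Bessel's inequality for characters that are pairwise orthogonal in \<open>L\<^sup>2\<close>, which is what the
  vanishing of the Fourier transform at the differences of frequencies says. The proof expands
  the squared distance of \<open>\<phi>\<close> from its orthogonal projection \<open>\<psi>\<close>.\<close>

lemma bessel:
  fixes \<phi> :: "real ^ 'n \<Rightarrow> complex"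
  assumes F: "finite F" "\<And>g g'. g \<in> F \<Longrightarrow> g' \<in> F \<Longrightarrow> g \<noteq> g' \<Longrightarrow> fourier M (g - g') = 0"
    and \<phi> [measurable]: "\<phi> \<in> borel_measurable M" and C: "AE x in M. norm (\<phi> x) \<le> C" 
  shows "(\<Sum>g\<in>F. (cmod (LINT x|M. \<phi> x * e g x))\<^sup>2) \<le> C\<^sup>2"
proof -
  define c where "c g = (LINT x|M. \<phi> x * e g x)" for g
  define \<psi> where "\<psi> x = (\<Sum>g\<in>F. c g * e (- g) x)" for x
  have int: "integrable M f" if "f \<in> borel_measurable M" "AE x in M. norm (f x) \<le> K" for K and f :: "_ \<Rightarrow> complex"
    using integrable_const_bound that by blast
  have int1: "integrable M (\<lambda>x. \<phi> x * e g x)" for g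
    by (rule int[of _ C]) (use C in \<open>auto simp: norm_mult\<close>)
  have int1': "integrable M (\<lambda>x. cnj (\<phi> x) * e g x)" for g
    by (rule int[of _ C]) (use C in \<open>auto simp: norm_mult\<close>)
  have int2: "integrable M (\<lambda>x. \<phi> x * cnj (\<phi> x))"
  proof (rule int[of _ "C * C"])
    show "AE x in M. cmod (\<phi> x * cnj (\<phi> x)) \<le> C * C"
      using C by eventually_elim (auto simp: norm_mult intro!: mult_mono intro: order_trans[OF norm_ge_zero])
  qed simp
  have int3: "integrable M (e g)" for g
    by (rule int[of _ 1]) auto
  have I1: "(LINT x|M. \<phi> x * cnj (\<psi> x)) = (\<Sum>g\<in>F. of_real ((cmod (c g))\<^sup>2))"
  proof -
    have "(LINT x|M. \<phi> x * cnj (\<psi> x)) = (LINT x|M. (\<Sum>g\<in>F. cnj (c g) * (\<phi> x * e g x)))"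
      by (simp add: \<psi>_def e_cnj sum_distrib_left algebra_simps)
    also have "\<dots> = (\<Sum>g\<in>F. cnj (c g) * c g)"
      using int1 by (simp add: integral_sum c_def)
    finally show ?thesis by (simp add: complex_norm_square mult.commute del: of_real_power)
  qed
  have i1: "integrable M (\<lambda>x. \<phi> x * cnj (\<psi> x))"
  proof -
    have "\<phi> x * cnj (\<psi> x) = (\<Sum>g\<in>F. cnj (c g) * (\<phi> x * e g x))" for x
      by (simp add: \<psi>_def e_cnj sum_distrib_left algebra_simps)
    then show ?thesis using int1 by simp
  qed
  have I2: "(LINT x|M. cnj (\<phi> x) * \<psi> x) = (\<Sum>g\<in>F. of_real ((cmod (c g))\<^sup>2))"
  proof -
    have "(LINT x|M. cnj (\<phi> x) * \<psi> x) = cnj (LINT x|M. \<phi> x * cnj (\<psi> x))"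
      by (subst Bochner_Integration.integral_cnj[symmetric]) simp
    then show ?thesis unfolding I1 by simp
  qed
  have i2: "integrable M (\<lambda>x. cnj (\<phi> x) * \<psi> x)"
  proof -
    have "cnj (\<phi> x) * \<psi> x = (\<Sum>g\<in>F. c g * (cnj (\<phi> x) * e (- g) x))" for x
      by (simp add: \<psi>_def sum_distrib_left algebra_simps)
    then show ?thesis using int1' by simp
  qed
  have ee: "\<psi> x * cnj (\<psi> x) = (\<Sum>g\<in>F. \<Sum>g'\<in>F. c g * cnj (c g') * e (g' - g) x)" for x
    by (simp add: \<psi>_def e_cnj sum_product e_add[symmetric] mult_ac)
  have I3: "(LINT x|M. \<psi> x * cnj (\<psi> x)) = (\<Sum>g\<in>F. of_real ((cmod (c g))\<^sup>2))"
  proof -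
    have "(LINT x|M. \<psi> x * cnj (\<psi> x)) = (\<Sum>g\<in>F. \<Sum>g'\<in>F. c g * cnj (c g') * fourier M (g' - g))"
      unfolding ee fourier_e using int3 by (simp add: integral_sum)
    also have "\<dots> = (\<Sum>g\<in>F. \<Sum>g'\<in>F. if g' = g then c g * cnj (c g) else 0)"
      by (intro sum.cong refl) (auto simp: F fourier_0)
    also have "\<dots> = (\<Sum>g\<in>F. c g * cnj (c g))" using F by simp
    finally show ?thesis by (simp add: complex_norm_square del: of_real_power)
  qed
  have i3: "integrable M (\<lambda>x. \<psi> x * cnj (\<psi> x))"
    unfolding ee using int3 by simp
  have "complex_of_real ((cmod (\<phi> x - \<psi> x))\<^sup>2) = \<phi> x * cnj (\<phi> x) - \<phi> x * cnj (\<psi> x) - cnj (\<phi> x) * \<psi> x + \<psi> x * cnj (\<psi> x)" for x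
    by (simp add: complex_norm_square algebra_simps del: of_real_power)
  then have "(LINT x|M. complex_of_real ((cmod (\<phi> x - \<psi> x))\<^sup>2)) = (LINT x|M. \<phi> x * cnj (\<phi> x)) - (\<Sum>g\<in>F. of_real ((cmod (c g))\<^sup>2))"
    using int2 i1 i2 i3 I1 I2 I3 by simp
  then have eq: "complex_of_real (LINT x|M. (cmod (\<phi> x - \<psi> x))\<^sup>2) = of_real ((LINT x|M. (cmod (\<phi> x))\<^sup>2) - (\<Sum>g\<in>F. (cmod (c g))\<^sup>2))"
    by (simp flip: complex_norm_square integral_complex_of_real of_real_power)
  have "0 \<le> (LINT x|M. (cmod (\<phi> x - \<psi> x))\<^sup>2)" by simp
  then have "(\<Sum>g\<in>F. (cmod (c g))\<^sup>2) \<le> (LINT x|M. (cmod (\<phi> x))\<^sup>2)"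
    using eq[THEN of_real_eq_iff[THEN iffD1]] by linarith
  also have "\<dots> \<le> C\<^sup>2"
  proof (rule integral_le_const)
    show "AE x in M. (cmod (\<phi> x))\<^sup>2 \<le> C\<^sup>2"
      using C by eventually_elim (simp add: power_mono)
    then show "integrable M (\<lambda>x. (cmod (\<phi> x))\<^sup>2)"
      by (intro integrable_const_bound[of _ "C\<^sup>2"]) auto
  qed
  finally show ?thesis by (simp add: c_def)
qed

end

section \<open>Differentiability of sums of squared Fourier coefficients\<close>

lemma continuously_differentiable_isCont: "continuously_differentiable f \<Longrightarrow> isCont f x"
  unfolding continuously_differentiable_def by (metis has_derivative_continuous)

text \<open>A pointwise limit is continuously differentiable once the approximants admit linear
  approximations with a uniform quadratic error. The uniform bound at small scale forces the
  linear parts to converge, it passes to the limit, and applied at two base points it shows that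
  the limit derivative is Lipschitz.\<close>

lemma C1_limit:
  fixes s :: "nat \<Rightarrow> real ^ 'n \<Rightarrow> real"
  assumes lin: "\<And>n t. linear (D n t)"
    and quad: "\<And>n t h. \<bar>s n (t + h) - s n t - D n t h\<bar> \<le> C * (norm h)\<^sup>2"
    and lim: "\<And>t. (\<lambda>n. s n t) \<longlonglongrightarrow> \<sigma> t"
  shows "continuously_differentiable \<sigma>"
proof -
  have C: "C \<ge> 0"
    using order_trans[OF abs_ge_zero quad[of 0 0 1]] by (simp add: zero_le_mult_iff)
  have "Cauchy (\<lambda>n. D n t h)" for t h
  proof (rule metric_CauchyI)
    fix \<epsilon> :: real assume \<epsilon>: "0 < \<epsilon>"
    \<comment> \<open>The step is so small that the quadratic errors are at most half of the increment
      \<open>\<delta> * \<epsilon>\<close> allowed for the linear parts at \<open>\<delta> *\<^sub>R h\<close>; the convergence of \<open>s n\<close> pays for the rest.\<close>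
    define \<delta> where "\<delta> = \<epsilon> / (4 * (C * (norm h)\<^sup>2 + 1))"
    have den: "C * (norm h)\<^sup>2 + 1 > 0" using C by (simp add: add_nonneg_pos)
    then have \<delta>: "\<delta> > 0" using \<epsilon> by (simp add: \<delta>_def)
    have \<delta>\<epsilon>: "2 * C * (norm (\<delta> *\<^sub>R h))\<^sup>2 \<le> \<delta> * \<epsilon> / 2"
    proof -
      have "\<delta> * (C * (norm h)\<^sup>2) \<le> \<delta> * (C * (norm h)\<^sup>2 + 1)" using \<delta> by simp
      also have "\<dots> = \<epsilon> / 4" using den unfolding \<delta>_def by (simp del: distrib_left_numeral)
      finally have "2 * \<delta> * (\<delta> * (C * (norm h)\<^sup>2)) \<le> 2 * \<delta> * (\<epsilon> / 4)"
        using \<delta> by (intro mult_left_mono) auto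
      then show ?thesis by (simp add: power2_eq_square algebra_simps)
    qed
    have "Cauchy (\<lambda>n. s n (t + \<delta> *\<^sub>R h))" "Cauchy (\<lambda>n. s n t)"
      using lim by (blast intro: LIMSEQ_imp_Cauchy)+
    moreover have "\<delta> * \<epsilon> / 4 > 0" using \<delta> \<epsilon> by simp
    ultimately obtain N1 N2 where
      N1: "\<And>m n. m \<ge> N1 \<Longrightarrow> n \<ge> N1 \<Longrightarrow> dist (s m (t + \<delta> *\<^sub>R h)) (s n (t + \<delta> *\<^sub>R h)) < \<delta> * \<epsilon> / 4" and
      N2: "\<And>m n. m \<ge> N2 \<Longrightarrow> n \<ge> N2 \<Longrightarrow> dist (s m t) (s n t) < \<delta> * \<epsilon> / 4"
      unfolding Cauchy_def by meson
    have "dist (D m t h) (D n t h) < \<epsilon>" if "m \<ge> max N1 N2" "n \<ge> max N1 N2" for m n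
    proof -
      have "\<bar>D m t (\<delta> *\<^sub>R h) - D n t (\<delta> *\<^sub>R h)\<bar> < \<delta> * \<epsilon>"
        using quad[of m t "\<delta> *\<^sub>R h"] quad[of n t "\<delta> *\<^sub>R h"] N1[of m n] N2[of m n] that \<delta>\<epsilon>
        unfolding dist_real_def by linarith
      then have "\<delta> * \<bar>D m t h - D n t h\<bar> < \<delta> * \<epsilon>"
        using \<delta> by (simp add: linear_cmul[OF lin] abs_mult flip: right_diff_distrib)
      then show ?thesis using \<delta> by (simp add: dist_real_def)
    qed
    then show "\<exists>N. \<forall>m\<ge>N. \<forall>n\<ge>N. dist (D m t h) (D n t h) < \<epsilon>" by blast
  qed
  then have "\<exists>l. (\<lambda>n. D n t h) \<longlonglongrightarrow> l" for t h
    by (simp add: real_Cauchy_convergent[unfolded convergent_def])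
  then obtain E where E: "\<And>t h. (\<lambda>n. D n t h) \<longlonglongrightarrow> E t h" by metis
  have linE: "linear (E t)" for t
  proof (rule linearI)
    fix x y :: "real ^ 'n" and c :: real
    show "E t (x + y) = E t x + E t y"
      by (rule LIMSEQ_unique[OF E]) (simp add: linear_add[OF lin] tendsto_add E)
    show "E t (c *\<^sub>R x) = c *\<^sub>R E t x"
      by (rule LIMSEQ_unique[OF E]) (simp add: linear_cmul[OF lin] tendsto_mult E)
  qed
  then have blE: "bounded_linear (E t)" for t by (simp add: linear_conv_bounded_linear)
  have quadE: "\<bar>\<sigma> (t + h) - \<sigma> t - E t h\<bar> \<le> C * (norm h)\<^sup>2" for t h
    by (rule LIMSEQ_le_const2[OF tendsto_rabs[OF tendsto_diff[OF tendsto_diff[OF lim lim] E]]])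
       (use quad in blast)
  define f' where "f' t = Blinfun (E t)" for t
  have f': "blinfun_apply (f' t) = E t" for t
    by (simp add: f'_def bounded_linear_Blinfun_apply blE)
  have "(\<sigma> has_derivative E t) (at t)" for t
    unfolding has_derivative_at
  proof (intro conjI blE)
    show "(\<lambda>h. norm (\<sigma> (t + h) - \<sigma> t - E t h) / norm h) \<midarrow>0\<rightarrow> 0"
    proof (rule Lim_null_comparison)
      show "(\<lambda>h. C * norm h) \<midarrow>(0 :: real ^ 'n)\<rightarrow> 0" using tendsto_mult_right_zero[OF tendsto_norm_zero[OF tendsto_ident_at]] .
      show "\<forall>\<^sub>F h in at 0. norm (norm (\<sigma> (t + h) - \<sigma> t - E t h) / norm h) \<le> C * norm h"
      proof (intro always_eventually allI)
        fix h show "norm (norm (\<sigma> (t + h) - \<sigma> t - E t h) / norm h) \<le> C * norm h"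
          using quadE[of t h] by (cases "h = 0") (auto simp: field_simps power2_eq_square)
      qed
    qed
  qed
  moreover have "continuous_on UNIV f'"
  proof (rule lipschitz_on_continuous_on)
    have "norm (f' t - f' u) \<le> 6 * C * norm (t - u)" for t u
    proof (rule norm_blinfun_bound)
      fix k
      define \<delta> where "\<delta> = norm (t - u)"
      \<comment> \<open>Compare \<open>\<sigma> (t + k')\<close> with \<open>\<sigma> t\<close>, and both of them with \<open>\<sigma> u\<close>: the three quadratic
        errors are at most \<open>C \<delta>\<^sup>2\<close>, \<open>C \<delta>\<^sup>2\<close> and \<open>4 C \<delta>\<^sup>2\<close>.\<close>
      have key: "\<bar>E t k' - E u k'\<bar> \<le> 6 * C * \<delta>\<^sup>2" if k': "norm k' = \<delta>" for k'
      proof -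
        have "norm (t - u + k') \<le> 2 * \<delta>"
          using norm_triangle_ineq[of "t - u" k'] k' by (simp add: \<delta>_def)
        then have "C * (norm (t - u + k'))\<^sup>2 \<le> C * (2 * \<delta>)\<^sup>2"
          using C by (intro mult_left_mono power_mono) auto
        moreover have "\<bar>\<sigma> (t + k') - \<sigma> u - E u (t - u + k')\<bar> \<le> C * (norm (t - u + k'))\<^sup>2"
          using quadE[of u "t - u + k'"] by (simp add: algebra_simps)
        moreover have "\<bar>\<sigma> t - \<sigma> u - E u (t - u)\<bar> \<le> C * \<delta>\<^sup>2"
          using quadE[of u "t - u"] by (simp add: \<delta>_def)
        moreover have "\<bar>\<sigma> (t + k') - \<sigma> t - E t k'\<bar> \<le> C * \<delta>\<^sup>2"
          using quadE[of t k'] k' by simp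
        ultimately show ?thesis by (simp add: linear_add[OF linE] power_mult_distrib)
      qed
      show "norm (blinfun_apply (f' t - f' u) k) \<le> 6 * C * norm (t - u) * norm k"
      proof (cases "k = 0 \<or> t = u")
        case False
        then have pos: "norm k > 0" "\<delta> > 0" by (auto simp: \<delta>_def)
        define c where "c = \<delta> / norm k"
        have c: "c > 0" using pos by (simp add: c_def)
        have "\<bar>E t (c *\<^sub>R k) - E u (c *\<^sub>R k)\<bar> \<le> 6 * C * \<delta>\<^sup>2"
          using pos by (intro key) (simp add: c_def)
        moreover have "E t (c *\<^sub>R k) - E u (c *\<^sub>R k) = c * (E t k - E u k)"
          by (simp add: linear_cmul[OF linE] right_diff_distrib)
        moreover have "6 * C * \<delta>\<^sup>2 = c * (6 * C * \<delta> * norm k)"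
          using pos by (simp add: c_def power2_eq_square)
        ultimately have "c * \<bar>E t k - E u k\<bar> \<le> c * (6 * C * \<delta> * norm k)"
          using c by (simp add: abs_mult)
        then show ?thesis using c by (simp add: f' blinfun.diff_left \<delta>_def)
      qed (auto simp: blinfun.zero_right)
    qed (use C in auto)
    then show "(6 * C)-lipschitz_on UNIV f'"
      using C by (simp add: lipschitz_on_def dist_norm)
  qed
  ultimately show ?thesis
    unfolding continuously_differentiable_def using f' by (intro exI[of _ f']) auto
qed

context borel_prob
begin

text \<open>The finite sums \<open>\<Sum>g\<in>F. \<bar>fourier M (t + g)\<bar>\<^sup>2\<close> have linear approximations with a quadratic error
  that does not depend on \<open>F\<close>. Each sum is the squared length of the projection of the character
  \<open>e t\<close> to the span of the characters with frequencies in \<open>F\<close>. Bessel's inequality bounds the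
  projections of the first and second order Taylor remainders of \<open>t \<mapsto> e t\<close>, and on a bounded
  support these remainders are \<open>O(norm h)\<close> and \<open>O((norm h)\<^sup>2)\<close>.\<close>

lemma partial_sum_quadratic_expansion:
  assumes F: "finite F" "\<And>g g'. g \<in> F \<Longrightarrow> g' \<in> F \<Longrightarrow> g \<noteq> g' \<Longrightarrow> fourier M (g - g') = 0"
    and K: "AE x in M. norm x \<le> K" "K > 0"
  shows "\<exists>D. (\<forall>t. linear (D t)) \<and> (\<forall>t h. \<bar>(\<Sum>g\<in>F. (cmod (fourier M (t + h + g)))\<^sup>2)
     - (\<Sum>g\<in>F. (cmod (fourier M (t + g)))\<^sup>2) - D t h\<bar> \<le> 9 * pi\<^sup>2 * K\<^sup>2 * (norm h)\<^sup>2)"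
proof -
  define u where "u g t = fourier M (t + g)" for g t
  define du where "du g t h = (LINT x|M. (\<i> * of_real (2 * pi * (h \<bullet> x))) * e t x * e g x)" for g t h
  define D where "D t h = (\<Sum>g\<in>F. 2 * Re (cnj (u g t) * du g t h))" for t h
  have hx: "AE x in M. \<bar>2 * pi * (h \<bullet> x)\<bar> \<le> 2 * pi * K * norm h" for h
    using K(1)
  proof eventually_elim
    case (elim x)
    have "\<bar>h \<bullet> x\<bar> \<le> norm h * norm x" by (rule Cauchy_Schwarz_ineq2)
    also have "\<dots> \<le> norm h * K" using elim by (rule mult_left_mono) simp
    finally show ?case by (simp add: abs_mult algebra_simps)
  qed
  have int_e: "integrable M (\<lambda>x. e t x * e g x)" for t g
    by (rule integrable_const_bound[of _ 1]) (auto simp: norm_mult)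
  have int_du: "integrable M (\<lambda>x. (\<i> * of_real (2 * pi * (h \<bullet> x))) * e t x * e g x)" for g t h
  proof (rule integrable_const_bound)
    show "AE x in M. norm ((\<i> * of_real (2 * pi * (h \<bullet> x))) * e t x * e g x) \<le> 2 * pi * K * norm h"
      using hx[of h] by eventually_elim (simp add: norm_mult abs_mult)
  qed measurable
  have u: "u g t = (LINT x|M. e t x * e g x)" for g t
    by (simp add: u_def fourier_e e_add)
  have lin: "linear (D t)" for t
  proof (rule linearI)
    fix h k :: "real ^ 'n" and c :: real
    have "du g t (h + k) = du g t h + du g t k" for g
      unfolding du_def by (subst Bochner_Integration.integral_add[OF int_du int_du, symmetric])
        (simp add: inner_add_left algebra_simps)
    then show "D t (h + k) = D t h + D t k"
      by (simp add: D_def distrib_left sum.distrib)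
    have "du g t (c *\<^sub>R h) = of_real c * du g t h" for g
      unfolding du_def by (subst integral_mult_right_zero[symmetric]) (simp add: algebra_simps)
    then show "D t (c *\<^sub>R h) = c *\<^sub>R D t h"
      by (simp add: D_def sum_distrib_left mult.left_commute[of _ "of_real c"] algebra_simps)
  qed
  have quad: "\<bar>(\<Sum>g\<in>F. (cmod (u g (t + h)))\<^sup>2) - (\<Sum>g\<in>F. (cmod (u g t))\<^sup>2) - D t h\<bar> \<le> 9 * pi\<^sup>2 * K\<^sup>2 * (norm h)\<^sup>2" for t h
  proof (cases "h = 0")
    case True
    then show ?thesis by (simp add: linear_0[OF lin])
  next
    case False
    define a where "a = 2 * pi * K * norm h"
    have a: "a > 0" using False K by (simp add: a_def)
    define v where "v g = u g (t + h) - u g t" for g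
    define r where "r g = v g - du g t h" for g
    have "(\<Sum>g\<in>F. (cmod (u g t))\<^sup>2) \<le> 1\<^sup>2"
      unfolding u by (rule bessel[OF F]) auto
    then have bu: "(\<Sum>g\<in>F. (cmod (u g t))\<^sup>2) \<le> 1" by simp
    have veq: "v g = (LINT x|M. (e (t + h) x - e t x) * e g x)" for g
      unfolding v_def u by (subst Bochner_Integration.integral_diff[symmetric]) (auto simp: int_e left_diff_distrib)
    have req: "r g = (LINT x|M. (e (t + h) x - e t x - (\<i> * of_real (2 * pi * (h \<bullet> x))) * e t x) * e g x)" for g
    proof -
      have "integrable M (\<lambda>x. (e (t + h) x - e t x) * e g x)"
        unfolding left_diff_distrib by (intro Bochner_Integration.integrable_diff int_e)
      then show ?thesis
        unfolding r_def veq du_def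
        by (subst Bochner_Integration.integral_diff[symmetric]) (auto simp: int_du[simplified] left_diff_distrib)
    qed
    have "(\<Sum>g\<in>F. (cmod (v g))\<^sup>2) \<le> a\<^sup>2"
      unfolding veq
    proof (rule bessel[OF F])
      show "AE x in M. norm (e (t + h) x - e t x) \<le> a"
        using hx[of h]
      proof eventually_elim
        case (elim x)
        have "norm (e (t + h) x - e t x) = norm (e t x * (iexp (2 * pi * (h \<bullet> x)) - 1))"
          by (simp add: e_add right_diff_distrib) (simp add: e_def cis_conv_exp)
        also have "\<dots> \<le> \<bar>2 * pi * (h \<bullet> x)\<bar>"
          using iexp_approx1[of "2 * pi * (h \<bullet> x)" 0] by (simp add: norm_mult)
        finally show ?case using elim by (simp add: a_def)
      qed
    qed measurable
    moreover have br: "(\<Sum>g\<in>F. (cmod (r g))\<^sup>2) \<le> (a\<^sup>2 / 2)\<^sup>2"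
      unfolding req
    proof (rule bessel[OF F])
      show "AE x in M. norm (e (t + h) x - e t x - (\<i> * of_real (2 * pi * (h \<bullet> x))) * e t x) \<le> a\<^sup>2 / 2"
        using hx[of h]
      proof eventually_elim
        case (elim x)
        define \<theta> where "\<theta> = 2 * pi * (h \<bullet> x)"
        have "e (t + h) x - e t x - (\<i> * of_real \<theta>) * e t x = e t x * (iexp \<theta> - (1 + \<i> * of_real \<theta>))"
          by (simp add: e_add \<theta>_def algebra_simps) (simp add: e_def cis_conv_exp mult_ac)
        then have "norm (e (t + h) x - e t x - (\<i> * of_real \<theta>) * e t x) \<le> \<bar>\<theta>\<bar>\<^sup>2 / 2"
          using iexp_approx1[of \<theta> 1] by (simp add: norm_mult numeral_2_eq_2)
        also have "\<dots> \<le> a\<^sup>2 / 2"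
          using elim by (intro divide_right_mono power_mono) (auto simp: \<theta>_def a_def)
        finally show ?case by (simp add: \<theta>_def)
      qed
    qed measurable
    moreover have "\<bar>(cmod (u g (t + h)))\<^sup>2 - (cmod (u g t))\<^sup>2 - 2 * Re (cnj (u g t) * du g t h)\<bar>
        \<le> (cmod (v g))\<^sup>2 + (a\<^sup>2 * (cmod (u g t))\<^sup>2 + (cmod (r g))\<^sup>2 / a\<^sup>2)" for g
    proof -
      \<comment> \<open>The cross term is split by \<open>2xy \<le> a\<^sup>2 x\<^sup>2 + y\<^sup>2 / a\<^sup>2\<close>, a weight for which both parts
        contribute multiples of \<open>a\<^sup>2\<close> after summation.\<close>
      have uv: "u g (t + h) = u g t + v g" and dr: "du g t h = v g - r g" by (simp_all add: v_def r_def)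
      have "(cmod (u g (t + h)))\<^sup>2 - (cmod (u g t))\<^sup>2 - 2 * Re (cnj (u g t) * du g t h)
          = (cmod (v g))\<^sup>2 + 2 * Re (cnj (u g t) * r g)"
        unfolding uv dr cmod_power2 by (simp add: power2_eq_square algebra_simps)
      moreover have "\<bar>Re (cnj (u g t) * r g)\<bar> \<le> cmod (u g t) * cmod (r g)"
        using abs_Re_le_cmod[of "cnj (u g t) * r g"] by (simp add: norm_mult)
      moreover have "2 * (cmod (u g t) * cmod (r g)) \<le> a\<^sup>2 * (cmod (u g t))\<^sup>2 + (cmod (r g))\<^sup>2 / a\<^sup>2"
        using sum_squares_bound[of "a * cmod (u g t)" "cmod (r g) / a"] a
        by (simp add: power_mult_distrib power_divide)
      ultimately show ?thesis by (smt (verit) zero_le_power2)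
    qed
    then have "\<bar>\<Sum>g\<in>F. (cmod (u g (t + h)))\<^sup>2 - (cmod (u g t))\<^sup>2 - 2 * Re (cnj (u g t) * du g t h)\<bar>
        \<le> (\<Sum>g\<in>F. (cmod (v g))\<^sup>2 + (a\<^sup>2 * (cmod (u g t))\<^sup>2 + (cmod (r g))\<^sup>2 / a\<^sup>2))"
      by (intro order_trans[OF sum_abs] sum_mono)
    moreover have "\<dots> = (\<Sum>g\<in>F. (cmod (v g))\<^sup>2) + (a\<^sup>2 * (\<Sum>g\<in>F. (cmod (u g t))\<^sup>2) + (\<Sum>g\<in>F. (cmod (r g))\<^sup>2) / a\<^sup>2)"
      by (simp add: sum.distrib sum_distrib_left sum_divide_distrib)
    moreover have "a\<^sup>2 * (\<Sum>g\<in>F. (cmod (u g t))\<^sup>2) \<le> a\<^sup>2 * 1"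
      using bu by (intro mult_left_mono) auto
    moreover have "(\<Sum>g\<in>F. (cmod (r g))\<^sup>2) / a\<^sup>2 \<le> (a\<^sup>2 / 2)\<^sup>2 / a\<^sup>2"
      using br by (intro divide_right_mono) auto
    moreover have "(a\<^sup>2 / 2)\<^sup>2 / a\<^sup>2 = a\<^sup>2 / 4" using a by (simp add: power2_eq_square)
    ultimately have "\<bar>\<Sum>g\<in>F. (cmod (u g (t + h)))\<^sup>2 - (cmod (u g t))\<^sup>2 - 2 * Re (cnj (u g t) * du g t h)\<bar> \<le> 9 / 4 * a\<^sup>2"
      by linarith
    then show ?thesis by (simp add: D_def sum_subtractf a_def power_mult_distrib mult_ac)
  qed
  from lin quad show ?thesis unfolding u_def by blast
qed

end

section \<open>Symmetry of Hadamard systems\<close>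

lemma expansive_transpose:
  assumes "expansive R"
  shows "expansive (transpose R)"
  unfolding expansive_def
proof (intro allI impI)
  fix z :: complex and v :: "complex ^ 'a"
  let ?C = "map_matrix complex_of_real R"
  assume v: "v \<noteq> 0 \<and> map_matrix complex_of_real (transpose R) *v v = z *s v"
  have sub: "(X - mat z) *v w = X *v w - z *s w" for X :: "complex ^ 'a ^ 'a" and w
    unfolding matrix_vector_mult_diff_rdistrib
    by (simp add: matrix_vector_mult_def mat_def vec_eq_iff mult_delta_left)
  have inv: "invertible X \<longleftrightarrow> (\<forall>x. X *v x = 0 \<longrightarrow> x = 0)" for X :: "complex ^ 'a ^ 'a"
    by (simp add: invertible_left_inverse matrix_left_invertible_ker)
  have "transpose (?C - mat z) = map_matrix complex_of_real (transpose R) - mat z"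
    by (simp add: transpose_def mat_def vec_eq_iff)
  then have "\<not> invertible (transpose (?C - mat z))"
    using v unfolding inv by (auto simp: sub)
  then have "\<not> invertible (?C - mat z)" by (simp add: invertible_det_nz det_transpose)
  then obtain w where "w \<noteq> 0" "?C *v w = z *s w" unfolding inv by (auto simp: sub)
  then show "1 < cmod z" using assms unfolding expansive_def by blast
qed

lemma funpow_transpose:
  fixes R :: "real ^ 'n ^ 'n"
  shows "((*v) (transpose R) ^^ k) x \<bullet> y = x \<bullet> ((*v) R ^^ k) y"
proof (induction k arbitrary: y)
  case (Suc k)
  show ?case
    using Suc[of "R *v y"] by (simp add: inner_transpose funpow_swap1[of "(*v) R"] del: transpose_matrix_vector)
qed simp

text \<open>Exchanging \<open>(R, B)\<close> with \<open>(R\<^sup>T, L)\<close> transposes the unitary matrix. Hence every one-sided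
  result also holds with the roles of \<open>B\<close> and \<open>L\<close> exchanged.\<close>

lemma hadamard_system_transpose:
  assumes "hadamard_system R B L"
  shows "hadamard_system (transpose R) L B"
proof -
  have inv: "invertible R" using assms by (auto simp: hadamard_system_def intro: expansive_imp_invertible)
  have adj: "(matrix_inv (transpose R) *v l) \<bullet> b = (matrix_inv R *v b) \<bullet> l" for b l
    unfolding matrix_inv_transpose[OF inv] inner_transpose by (rule inner_commute)
  have swap: "((*v) (transpose R) ^^ k) l \<bullet> b = ((*v) R ^^ k) b \<bullet> l" for k b l
    unfolding funpow_transpose by (rule inner_commute)
  have transposed: "unitary_on L B (\<lambda>l b. U b l)" if "unitary_on B L U" for U
  proof -
    have "(\<Sum>l\<in>L. cnj (U b l) * U b' l) = (if b = b' then 1 else 0)" if "b \<in> B" "b' \<in> B" for b b'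
      using \<open>unitary_on B L U\<close> that unfolding unitary_on_def by (simp add: mult.commute[of "cnj _"] eq_commute[of b])
    moreover have "(\<Sum>b\<in>B. U b l * cnj (U b l')) = (if l = l' then 1 else 0)" if "l \<in> L" "l' \<in> L" for l l'
      using \<open>unitary_on B L U\<close> that unfolding unitary_on_def by (simp add: mult.commute[of _ "cnj _"] eq_commute[of l])
    ultimately show ?thesis unfolding unitary_on_def by blast
  qed
  have "unitary_on L B (\<lambda>l b. complex_of_real (1 / sqrt (real (card L))) *
      cis (2 * pi * ((matrix_inv (transpose R) *v l) \<bullet> b)))"
  proof -
    have card: "card L = card B" using assms by (simp add: hadamard_system_def)
    show ?thesis
      unfolding adj card by (rule transposed) (use assms in \<open>unfold hadamard_system_def, blast\<close>)
  qed
  then show ?thesis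
    using assms expansive_transpose[of R]
    by (simp add: hadamard_system_def swap del: transpose_matrix_vector) (simp add: transpose_def)
qed

section \<open>Digit expansions and periodicity of the mask\<close>

text \<open>The sums \<open>c\<^sub>0 + S c\<^sub>1 + \<dots> + S\<^bsup>n-1\<^esup> c\<^bsub>n-1\<^esub>\<close> of exactly \<open>n\<close> digits. Splitting off the lowest
  digit matches the recursion of the transfer operator.\<close>

primrec digit_sums :: "real ^ 'n ^ 'n \<Rightarrow> (real ^ 'n) set \<Rightarrow> nat \<Rightarrow> (real ^ 'n) set" where
  "digit_sums S C 0 = {0}"
| "digit_sums S C (Suc n) = (\<lambda>(c, g). c + S *v g) ` (C \<times> digit_sums S C n)"

lemma digit_set_eq_Union: "digit_set S C = (\<Union>n. digit_sums S C (Suc n))"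
proof -
  have "x \<in> digit_sums S C (Suc n) \<longleftrightarrow>
      (\<exists>a. (\<forall>k\<le>n. a k \<in> C) \<and> x = (\<Sum>k\<le>n. ((*v) S ^^ k) (a k)))" for n x
  proof (induction n arbitrary: x)
    case 0
    show ?case by (force simp: image_iff intro: exI[of _ "\<lambda>_. x"])
  next
    case (Suc n)
    have step: "(\<Sum>k\<le>Suc n. ((*v) S ^^ k) (a k)) = a 0 + S *v (\<Sum>k\<le>n. ((*v) S ^^ k) (a (Suc k)))" for a
      unfolding sum.atMost_Suc_shift by (simp add: linear_sum[OF matrix_vector_mul_linear])
    show ?case
    proof
      assume "x \<in> digit_sums S C (Suc (Suc n))"
      then obtain c g where cg: "c \<in> C" "g \<in> digit_sums S C (Suc n)" "x = c + S *v g"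
        unfolding digit_sums.simps(2)[of S C "Suc n"] by auto
      from cg(2)[unfolded Suc] obtain a where "\<forall>k\<le>n. a k \<in> C" "g = (\<Sum>k\<le>n. ((*v) S ^^ k) (a k))" by blast
      then have "(\<forall>k\<le>Suc n. case_nat c a k \<in> C) \<and> x = (\<Sum>k\<le>Suc n. ((*v) S ^^ k) (case_nat c a k))"
        unfolding step using cg by (auto split: nat.split)
      then show "\<exists>a. (\<forall>k\<le>Suc n. a k \<in> C) \<and> x = (\<Sum>k\<le>Suc n. ((*v) S ^^ k) (a k))" by (intro exI[of _ "case_nat c a"])
    next
      assume "\<exists>a. (\<forall>k\<le>Suc n. a k \<in> C) \<and> x = (\<Sum>k\<le>Suc n. ((*v) S ^^ k) (a k))"
      then obtain a where a: "\<forall>k\<le>Suc n. a k \<in> C" "x = a 0 + S *v (\<Sum>k\<le>n. ((*v) S ^^ k) (a (Suc k)))"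
        unfolding step by blast
      have "(\<Sum>k\<le>n. ((*v) S ^^ k) (a (Suc k))) \<in> digit_sums S C (Suc n)"
        unfolding Suc by (rule exI[of _ "\<lambda>k. a (Suc k)"]) (use a(1) in simp)
      then show "x \<in> digit_sums S C (Suc (Suc n))"
        unfolding digit_sums.simps(2)[of S C "Suc n"] a(2) using a(1)
        by (intro image_eqI[where x="(a 0, \<Sum>k\<le>n. ((*v) S ^^ k) (a (Suc k)))"]) simp_all
    qed
  qed
  then show ?thesis unfolding digit_set_def by blast
qed

lemma finite_digit_sums: "finite C \<Longrightarrow> finite (digit_sums S C n)"
  by (induction n) auto

lemma zero_in_digit_sums: "0 \<in> C \<Longrightarrow> 0 \<in> digit_sums S C n"
  by (induction n) (force simp: image_iff)+

lemma digit_sums_mono: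
  assumes "0 \<in> C" "m \<le> n"
  shows "digit_sums S C m \<subseteq> digit_sums S C n"
proof -
  have "digit_sums S C n \<subseteq> digit_sums S C (Suc n)" for n
  proof (induction n)
    case 0
    show ?case using zero_in_digit_sums[OF assms(1), of S "Suc 0"] by simp
  next
    case (Suc n)
    show ?case unfolding digit_sums.simps(2)[of S C "Suc n"] digit_sums.simps(2)[of S C n]
      using Suc by (intro image_mono Sigma_mono) auto
  qed
  then show ?thesis using assms(2) by (rule lift_Suc_mono_le)
qed

lemma mask_periodic:
  assumes "\<And>a. a \<in> A \<Longrightarrow> a \<bullet> z \<in> \<int>"
  shows "mask A (x + z) = mask A x"
proof -
  have "cis (2 * pi * (a \<bullet> (x + z))) = cis (2 * pi * (a \<bullet> x))" if "a \<in> A" for a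
  proof -
    have "cis (2 * pi * (a \<bullet> (x + z))) = cis (2 * pi * (a \<bullet> x)) * cis (2 * pi * (a \<bullet> z))"
      by (simp add: cis_mult inner_add_right algebra_simps)
    then show ?thesis using assms[OF that] by (simp add: cis_multiple_2pi)
  qed
  then show ?thesis by (simp add: mask_def)
qed

section \<open>Iterates of the transfer operator\<close>

text \<open>One side of the symmetry: the transfer operator \<open>T\<close> with mask \<open>B\<close> and branches from \<open>L\<close>, and
  the spectral function \<open>\<sigma>\<close> of the measure \<open>\<mu>\<close> of \<open>(R, B)\<close>. \<open>Si\<close> is multiplication by the inverse
  of \<open>S\<close>.\<close>
locale hadamard =
  fixes R :: "real ^ 'n ^ 'n" and B L :: "(real ^ 'n) set"
  assumes hadamard: "hadamard_system R B L"
begin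

abbreviation S :: "real ^ 'n ^ 'n" where "S \<equiv> transpose R"
abbreviation T :: "(real ^ 'n \<Rightarrow> real) \<Rightarrow> real ^ 'n \<Rightarrow> real" where "T \<equiv> transfer_op S B L"
abbreviation Si :: "real ^ 'n \<Rightarrow> real ^ 'n" where "Si \<equiv> (*v) (matrix_inv S)"
abbreviation \<mu> :: "(real ^ 'n) measure" where "\<mu> \<equiv> ifs_measure R B"

text \<open>\<open>\<Gamma>\<close> is the full set of frequencies, and \<open>G n\<close> is its subset of \<open>n\<close>-digit sums.\<close>

abbreviation \<Gamma> :: "(real ^ 'n) set" where "\<Gamma> \<equiv> digit_set S L"
abbreviation G :: "nat \<Rightarrow> (real ^ 'n) set" where "G \<equiv> digit_sums S L"
abbreviation \<sigma> :: "real ^ 'n \<Rightarrow> real" where "\<sigma> \<equiv> spectral_function \<mu> \<Gamma>"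

text \<open>The unitary matrix of the Hadamard system.\<close>

definition U :: "real ^ 'n \<Rightarrow> real ^ 'n \<Rightarrow> complex" where
  "U b l = complex_of_real (1 / sqrt (real (card B))) * cis (2 * pi * ((matrix_inv R *v b) \<bullet> l))"

text \<open>The squared modulus of the Fourier transform, whose translates are summed by the spectral
  function.\<close>

definition g :: "real ^ 'n \<Rightarrow> real" where "g t = (cmod (fourier \<mu> t))\<^sup>2"

text \<open>The product of the \<open>n\<close> factors \<open>\<bar>mask B (S\<^bsup>-k\<^esup> x)\<bar>\<^sup>2\<close> for \<open>k = 1, \<dots>, n\<close>, a partial product of
  the infinite product for \<open>g x\<close>.\<close>

primrec p :: "nat \<Rightarrow> real ^ 'n \<Rightarrow> real" where
  "p 0 x = 1"
| "p (Suc n) x = (cmod (mask B (Si x)))\<^sup>2 * p n (Si x)"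

lemma fin: "finite B" "finite L" and zero: "0 \<in> B" "0 \<in> L" and ne: "B \<noteq> {}"
  and integral: "b \<in> B \<Longrightarrow> l \<in> L \<Longrightarrow> ((*v) R ^^ k) b \<bullet> l \<in> \<int>"
  and expansive_R: "expansive R" and unitary: "unitary_on B L U"
  using hadamard by (auto simp: hadamard_system_def U_def[abs_def])

lemma card_B: "card B > 0" using fin ne by (simp add: card_gt_0_iff)

lemma inv_sqrt_card:
  "complex_of_real (1 / sqrt (card B)) * complex_of_real (1 / sqrt (card B)) = 1 / of_nat (card B)"
  unfolding of_real_mult[symmetric] by simp

lemma inv_R: "invertible R" by (rule expansive_imp_invertible[OF expansive_R])

lemma expansive_S: "expansive S" by (rule expansive_transpose[OF expansive_R])

lemma inv_S: "invertible S" by (rule expansive_imp_invertible[OF expansive_S])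

lemma Si_S [simp]: "Si (S *v x) = x"
  by (simp add: matrix_vector_mul_assoc matrix_inv_mult[OF inv_S] del: transpose_matrix_vector)

lemma Si_tendsto_0: "(\<lambda>k. (Si ^^ k) x) \<longlonglongrightarrow> 0"
  using summable_LIMSEQ_zero[OF expansive_summable_orbit[OF expansive_S, of x]] by (simp add: tendsto_norm_zero_iff)

lemma Si_inner: "Si x \<bullet> y = x \<bullet> (matrix_inv R *v y)"
  by (simp only: matrix_inv_transpose[OF inv_R] inner_transpose)

text \<open>The frequencies pairing integrally with all \<open>R\<^sup>k b\<close>. They contain the digit sums and are
  periods of the mask; being preserved by \<open>z \<mapsto> l + S z\<close>, they make an induction on the number of
  digits work.\<close>

definition P :: "(real ^ 'n) set" where
  "P = {z. \<forall>b\<in>B. \<forall>k. ((*v) R ^^ k) b \<bullet> z \<in> \<int>}"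

lemma P_step: "z \<in> P \<Longrightarrow> l \<in> L \<Longrightarrow> l + S *v z \<in> P"
proof -
  assume z: "z \<in> P" and l: "l \<in> L"
  have "((*v) R ^^ k) b \<bullet> (S *v z) \<in> \<int>" if "b \<in> B" for b k
  proof -
    have "((*v) R ^^ k) b \<bullet> (S *v z) = ((*v) R ^^ Suc k) b \<bullet> z"
      by (simp add: inner_transpose inner_commute[of _ "S *v z"] inner_commute[of z] del: transpose_matrix_vector)
    then show ?thesis using z that by (simp add: P_def del: funpow.simps)
  qed
  then show ?thesis using integral l by (auto simp: P_def inner_add_right)
qed

lemma G_subset_P: "G n \<subseteq> P"
  by (induction n) (auto simp: P_step simp del: transpose_matrix_vector, simp add: P_def)

lemma P_inner: "z \<in> P \<Longrightarrow> b \<in> B \<Longrightarrow> b \<bullet> z \<in> \<int>"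
  unfolding P_def using funpow_0 by (metis (mono_tags, lifting) mem_Collect_eq)

text \<open>Digit expansions are unique: if two points with lowest digits \<open>l \<noteq> l'\<close> coincided, then
  \<open>R\<^bsup>-1\<^esup> b \<bullet> (l' - l)\<close> would be an integer for all \<open>b\<close>, and the columns \<open>l\<close> and \<open>l'\<close> of the
  unitary matrix would not be orthogonal.\<close>

lemma first_digit_unique:
  assumes "l \<in> L" "l' \<in> L" "z \<in> P" "z' \<in> P" "l + S *v z = l' + S *v z'"
  shows "l = l' \<and> z = z'"
proof -
  have "l = l'"
  proof (rule ccontr)
    assume "l \<noteq> l'"
    then have "(\<Sum>b\<in>B. cnj (U b l) * U b l') = 0"
      using unitary assms by (simp add: unitary_on_def)
    moreover have "cnj (U b l) * U b l' = 1 / of_nat (card B)" if "b \<in> B" for b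
    proof -
      have "l' - l = S *v (z - z')" using assms(5)
        by (simp add: matrix_vector_mult_diff_distrib algebra_simps del: transpose_matrix_vector)
      then have "(matrix_inv R *v b) \<bullet> (l' - l) = b \<bullet> (z - z')"
        by (metis Si_S Si_inner inner_commute)
      also have "\<dots> \<in> \<int>" using P_inner assms that by (simp add: inner_diff_right)
      finally have "cis (2 * pi * ((matrix_inv R *v b) \<bullet> (l' - l))) = 1" by (rule cis_multiple_2pi)
      moreover have "cnj (U b l) * U b l' =
          (complex_of_real (1 / sqrt (card B)) * complex_of_real (1 / sqrt (card B))) * cis (2 * pi * ((matrix_inv R *v b) \<bullet> (l' - l)))"
        by (simp add: U_def cis_cnj cis_mult inner_diff_right algebra_simps)
      ultimately show ?thesis unfolding inv_sqrt_card by simp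
    qed
    ultimately show False using card_B by simp
  qed
  then have "S *v z = S *v z'" using assms(5) by simp
  then show ?thesis using \<open>l = l'\<close> by (metis Si_S)
qed

text \<open>The values of the mask at the branches are, up to the factor \<open>1 / sqrt N\<close>, the product of the
  unitary matrix with a vector \<open>w\<close> of \<open>N\<close> unimodular entries, so their squared moduli add up
  to \<open>1\<close>.\<close>

lemma mask_branch_sum: "(\<Sum>l\<in>L. (cmod (mask B (affine_branch S l t)))\<^sup>2) = 1"
proof -
  define w where "w b = cis (2 * pi * (t \<bullet> (matrix_inv R *v b)))" for b
  have s: "sqrt (card B) > 0" using card_B by simp
  have m: "mask B (affine_branch S l t) = of_real (1 / sqrt (card B)) * (\<Sum>b\<in>B. w b * U b l)" for l
  proof -
    have "b \<bullet> affine_branch S l t = t \<bullet> (matrix_inv R *v b) + (matrix_inv R *v b) \<bullet> l" for b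
      by (simp only: affine_branch_def inner_commute[of b] Si_inner) (simp add: inner_add_left inner_commute)
    then have "mask B (affine_branch S l t) = 1 / of_nat (card B) * (\<Sum>b\<in>B. w b * cis (2 * pi * ((matrix_inv R *v b) \<bullet> l)))"
      by (simp add: mask_def w_def cis_mult distrib_left)
    also have "\<dots> = of_real (1 / sqrt (card B)) * (\<Sum>b\<in>B. w b * U b l)"
      unfolding inv_sqrt_card[symmetric] U_def by (simp only: sum_distrib_left mult_ac)
    finally show ?thesis .
  qed
  have "complex_of_real (\<Sum>l\<in>L. (cmod (mask B (affine_branch S l t)))\<^sup>2)
      = (\<Sum>l\<in>L. 1 / of_nat (card B) * (\<Sum>b\<in>B. \<Sum>b'\<in>B. w b * cnj (w b') * (U b l * cnj (U b' l))))"
  proof -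
    have "complex_of_real ((cmod (mask B (affine_branch S l t)))\<^sup>2)
       = 1 / of_nat (card B) * (\<Sum>b\<in>B. \<Sum>b'\<in>B. w b * cnj (w b') * (U b l * cnj (U b' l)))" for l
    proof -
      have "complex_of_real ((cmod (mask B (affine_branch S l t)))\<^sup>2) =
          (of_real (1 / sqrt (card B)) * of_real (1 / sqrt (card B))) * ((\<Sum>b\<in>B. w b * U b l) * (\<Sum>b'\<in>B. cnj (w b' * U b' l)))"
        unfolding complex_norm_square m by (simp add: mult_ac)
      then show ?thesis unfolding inv_sqrt_card by (simp add: sum_product mult_ac)
    qed
    then show ?thesis by simp
  qed
  also have "\<dots> = 1 / of_nat (card B) * (\<Sum>b\<in>B. \<Sum>b'\<in>B. w b * cnj (w b') * (\<Sum>l\<in>L. U b l * cnj (U b' l)))"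
    unfolding sum_distrib_left
    by (subst sum.swap, rule sum.cong[OF refl], rule sum.swap)
  also have "\<dots> = 1 / of_nat (card B) * (\<Sum>b\<in>B. \<Sum>b'\<in>B. if b' = b then w b * cnj (w b) else 0)"
    using unitary by (intro arg_cong2[where f="(*)"] sum.cong refl) (auto simp: unitary_on_def)
  also have "\<dots> = 1"
    using card_B fin ne by (simp add: w_def cis_cnj cis_mult)
  finally show ?thesis by (metis of_real_eq_1_iff)
qed

lemma T_1: "T (\<lambda>_. 1) = (\<lambda>_. 1)"
  by (rule ext) (simp add: transfer_op_def mask_branch_sum)

text \<open>By periodicity of the mask, the \<open>n\<close>-fold transfer operator is a sum over all \<open>n\<close>-digit
  translates; uniqueness of the expansion lets the sum run over the set \<open>G n\<close>.\<close>

lemma T_iterate: "(T ^^ n) f t = (\<Sum>\<gamma>\<in>G n. p n (t + \<gamma>) * f ((Si ^^ n) (t + \<gamma>)))"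
proof (induction n arbitrary: t)
  case (Suc n)
  have inj: "inj_on (\<lambda>(l, \<gamma>). l + S *v \<gamma>) (L \<times> G n)"
    by (intro inj_onI, clarify) (use first_digit_unique G_subset_P[of n] in blast)
  have "(T ^^ Suc n) f t = (\<Sum>l\<in>L. \<Sum>\<gamma>\<in>G n. (cmod (mask B (affine_branch S l t)))\<^sup>2 *
      (p n (affine_branch S l t + \<gamma>) * f ((Si ^^ n) (affine_branch S l t + \<gamma>))))"
    by (simp add: transfer_op_def Suc sum_distrib_left del: transpose_matrix_vector)
  also have "\<dots> = (\<Sum>l\<in>L. \<Sum>\<gamma>\<in>G n. p (Suc n) (t + (l + S *v \<gamma>)) * f ((Si ^^ Suc n) (t + (l + S *v \<gamma>))))"
  proof (intro sum.cong refl)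
    fix l \<gamma> assume \<gamma>: "\<gamma> \<in> G n"
    have "Si (t + (l + S *v \<gamma>)) = Si (t + l) + Si (S *v \<gamma>)"
      by (simp only: matrix_vector_right_distrib add.assoc[symmetric])
    then have eq: "Si (t + (l + S *v \<gamma>)) = affine_branch S l t + \<gamma>"
      by (simp only: affine_branch_def Si_S)
    have "mask B (affine_branch S l t + \<gamma>) = mask B (affine_branch S l t)"
      using \<gamma> G_subset_P P_inner by (intro mask_periodic) blast
    then show "(cmod (mask B (affine_branch S l t)))\<^sup>2 *
        (p n (affine_branch S l t + \<gamma>) * f ((Si ^^ n) (affine_branch S l t + \<gamma>))) =
        p (Suc n) (t + (l + S *v \<gamma>)) * f ((Si ^^ Suc n) (t + (l + S *v \<gamma>)))"
      by (simp only: p.simps eq funpow_Suc_right o_def mult.assoc)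
  qed
  also have "\<dots> = (\<Sum>\<gamma>\<in>G (Suc n). p (Suc n) (t + \<gamma>) * f ((Si ^^ Suc n) (t + \<gamma>)))"
    unfolding digit_sums.simps sum.reindex[OF inj] sum.cartesian_product
    by (intro sum.cong refl) (simp only: o_def case_prod_beta)
  finally show ?case .
qed simp

section \<open>Partial sums of the spectral function\<close>

lemma p_nonneg: "0 \<le> p n x"
  by (induction n arbitrary: x) auto

lemma ss: "self_similar R B \<mu>" and bounded_support: "\<exists>K. AE x in \<mu>. norm x \<le> K"
  using ifs_measure_properties[OF fin(1) ne expansive_summable_orbit[OF expansive_R]] by auto

sublocale M: borel_prob \<mu>
  using ss by (auto simp: self_similar_def borel_prob_def borel_prob_axioms_def)

lemma g_nonneg: "0 \<le> g t" and g_le_1: "g t \<le> 1" and g_0: "g 0 = 1"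
  by (auto simp: g_def M.norm_fourier_le M.fourier_0 power_le_one)

lemma g_eq: "g x = p n x * g ((Si ^^ n) x)"
proof (induction n arbitrary: x)
  case (Suc n)
  have "g x = (cmod (mask B (Si x)))\<^sup>2 * g (Si x)"
    unfolding g_def by (subst fourier_refinement[OF ss fin(1) ne inv_R]) (simp only: norm_mult power_mult_distrib)
  also have "g (Si x) = p n (Si x) * g ((Si ^^ n) (Si x))" by (rule Suc)
  finally show ?case by (simp only: p.simps funpow_Suc_right o_def mult.assoc)
qed simp

lemma T_iterate_g: "(T ^^ n) g t = (\<Sum>\<gamma>\<in>G n. g (t + \<gamma>))"
  unfolding T_iterate by (simp only: g_eq[symmetric])

lemma sum_G_le_1: "(\<Sum>\<gamma>\<in>G n. g (t + \<gamma>)) \<le> 1"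
proof -
  have "(\<Sum>\<gamma>\<in>G n. g (t + \<gamma>)) \<le> (\<Sum>\<gamma>\<in>G n. p n (t + \<gamma>) * 1)"
    unfolding T_iterate_g[symmetric] T_iterate by (intro sum_mono mult_left_mono g_le_1 p_nonneg)
  also have "\<dots> = (T ^^ n) (\<lambda>_. 1) t" by (simp only: T_iterate)
  also have "(T ^^ n) (\<lambda>_. 1) = (\<lambda>_. 1)"
    by (induction n) (simp_all add: T_1 del: transpose_matrix_vector)
  finally show ?thesis .
qed

lemma eventually_subset_G:
  assumes "finite F" "F \<subseteq> \<Gamma>"
  shows "\<forall>\<^sub>F n in sequentially. F \<subseteq> G n"
proof -
  have "\<forall>x\<in>F. \<forall>\<^sub>F n in sequentially. x \<in> G n"
  proof
    fix x assume "x \<in> F"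
    then obtain m where "x \<in> G (Suc m)" using assms(2) by (auto simp: digit_set_eq_Union simp del: digit_sums.simps)
    then show "\<forall>\<^sub>F n in sequentially. x \<in> G n"
      using digit_sums_mono[OF zero(2)] by (intro eventually_sequentiallyI[of "Suc m"]) blast
  qed
  then have "\<forall>\<^sub>F n in sequentially. \<forall>x\<in>F. x \<in> G n"
    using assms(1) by (simp add: eventually_ball_finite)
  then show ?thesis by eventually_elim blast
qed

lemma G_subset_\<Gamma>: "G n \<subseteq> \<Gamma>"
proof -
  have "G n \<subseteq> G (Suc n)" by (rule digit_sums_mono[OF zero(2)]) simp
  also have "\<dots> \<subseteq> \<Gamma>" unfolding digit_set_eq_Union by (rule UN_upper) simp
  finally show ?thesis .
qed

lemma G_exhausts: "filterlim G (finite_subsets_at_top \<Gamma>) sequentially"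
  unfolding filterlim_finite_subsets_at_top
  using eventually_subset_G G_subset_\<Gamma> finite_digit_sums[OF fin(2)] by (auto simp: eventually_conj_iff)

lemma sum_finite_le_1:
  assumes "finite F" "F \<subseteq> \<Gamma>"
  shows "(\<Sum>\<gamma>\<in>F. g (t + \<gamma>)) \<le> 1"
proof -
  obtain n where "F \<subseteq> G n" using eventually_subset_G[OF assms] by (auto simp: eventually_sequentially)
  then have "(\<Sum>\<gamma>\<in>F. g (t + \<gamma>)) \<le> (\<Sum>\<gamma>\<in>G n. g (t + \<gamma>))"
    by (intro sum_mono2 finite_digit_sums fin g_nonneg)
  then show ?thesis using sum_G_le_1 by (rule order_trans)
qed

lemma summable: "(\<lambda>\<gamma>. g (t + \<gamma>)) summable_on \<Gamma>"
  by (rule nonneg_bdd_above_summable_on) (auto simp: g_nonneg sum_finite_le_1 intro!: bdd_aboveI2[where M=1])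

lemma sigma_eq: "\<sigma> t = (\<Sum>\<^sub>\<infinity>\<gamma>\<in>\<Gamma>. g (t + \<gamma>))"
  by (simp add: spectral_function_def g_def)

lemma partial_sums_tendsto: "(\<lambda>n. \<Sum>\<gamma>\<in>G n. g (t + \<gamma>)) \<longlonglongrightarrow> \<sigma> t"
  using filterlim_compose[OF has_sum_infsum[OF summable, unfolded has_sum_def] G_exhausts, of t]
  by (simp add: sigma_eq)

lemma sigma_nonneg: "0 \<le> \<sigma> t"
  unfolding sigma_eq by (intro infsum_nonneg g_nonneg)

lemma sigma_le_1: "\<sigma> t \<le> 1"
  by (rule LIMSEQ_le_const2[OF partial_sums_tendsto]) (use sum_G_le_1 in blast)

lemma sigma_0: "\<sigma> 0 = 1"
proof (rule antisym[OF sigma_le_1])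
  have "g (0 + 0) \<le> (\<Sum>\<gamma>\<in>G n. g (0 + \<gamma>))" for n
    using zero_in_digit_sums[OF zero(2)] finite_digit_sums[OF fin(2)] by (intro member_le_sum) (auto simp: g_nonneg)
  then show "1 \<le> \<sigma> 0"
    by (intro LIMSEQ_le_const[OF partial_sums_tendsto]) (auto simp: g_0)
qed

lemma T_sigma: "T \<sigma> = \<sigma>"
proof
  fix t
  have lim: "(\<lambda>n. (T ^^ n) g x) \<longlonglongrightarrow> \<sigma> x" for x
    unfolding T_iterate_g by (rule partial_sums_tendsto)
  have "(\<lambda>n. T ((T ^^ n) g) t) \<longlonglongrightarrow> T \<sigma> t"
    unfolding transfer_op_def[of _ _ _ _ t] by (intro tendsto_intros lim)
  then have "(\<lambda>n. (T ^^ Suc n) g t) \<longlonglongrightarrow> T \<sigma> t" by simp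
  then show "T \<sigma> t = \<sigma> t"
    using LIMSEQ_unique LIMSEQ_Suc[OF lim[of t]] by blast
qed

section \<open>Regularity and minimality of the spectral function\<close>

text \<open>Orthogonality of the characters is read off from the bound on the sums: at the point
  \<open>-\<gamma>'\<close> the term of \<open>\<gamma>'\<close> is already \<open>1\<close>.\<close>

lemma orthogonal:
  assumes "\<gamma> \<in> \<Gamma>" "\<gamma>' \<in> \<Gamma>" "\<gamma> \<noteq> \<gamma>'"
  shows "fourier \<mu> (\<gamma> - \<gamma>') = 0"
proof -
  have "(\<Sum>x\<in>{\<gamma>, \<gamma>'}. g (- \<gamma>' + x)) \<le> 1" using assms by (intro sum_finite_le_1) auto
  then have "g (\<gamma> - \<gamma>') \<le> 0" using assms(3) by (simp add: g_0)
  then show ?thesis by (simp add: g_def)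
qed

lemma sigma_C1: "continuously_differentiable \<sigma>"
proof -
  obtain K where "AE x in \<mu>. norm x \<le> K" using bounded_support by blast
  then have K: "AE x in \<mu>. norm x \<le> \<bar>K\<bar> + 1" by eventually_elim simp
  have "\<exists>D. (\<forall>t. linear (D t)) \<and> (\<forall>t h. \<bar>(\<Sum>\<gamma>\<in>G n. g (t + h + \<gamma>)) - (\<Sum>\<gamma>\<in>G n. g (t + \<gamma>)) - D t h\<bar>
      \<le> 9 * pi\<^sup>2 * (\<bar>K\<bar> + 1)\<^sup>2 * (norm h)\<^sup>2)" for n
    unfolding g_def
  proof (rule M.partial_sum_quadratic_expansion[OF finite_digit_sums[OF fin(2)] _ K])
    show "fourier \<mu> (\<gamma> - \<gamma>') = 0" if "\<gamma> \<in> G n" "\<gamma>' \<in> G n" "\<gamma> \<noteq> \<gamma>'" for \<gamma> \<gamma>'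
      using that G_subset_\<Gamma>[of n] by (intro orthogonal) blast+
  qed simp
  then obtain D where "\<And>n t. linear (D n t)" "\<And>n t h. \<bar>(\<Sum>\<gamma>\<in>G n. g (t + h + \<gamma>)) - (\<Sum>\<gamma>\<in>G n. g (t + \<gamma>)) - D n t h\<bar>
      \<le> 9 * pi\<^sup>2 * (\<bar>K\<bar> + 1)\<^sup>2 * (norm h)\<^sup>2" by metis
  then show ?thesis by (rule C1_limit[OF _ _ partial_sums_tendsto])
qed

text \<open>In \<open>f = T\<^sup>n f\<close> only finitely many terms are kept. There \<open>f (S\<^bsup>-n\<^esup> (t + \<gamma>))\<close> tends to
  \<open>f 0 = 1\<close>, and the partial products tend to \<open>g (t + \<gamma>)\<close>.\<close>

lemma sigma_minimal:
  assumes f: "\<And>x. 0 \<le> f x" "T f = f" "f 0 = 1" "isCont f 0"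
  shows "\<sigma> t \<le> f t"
  unfolding sigma_eq
proof (rule infsum_le_finite_sums[OF summable])
  fix F assume F: "finite F" "F \<subseteq> \<Gamma>"
  have p_lim: "(\<lambda>n. p n x) \<longlonglongrightarrow> g x" for x
  proof -
    have gl: "(\<lambda>n. g ((Si ^^ n) x)) \<longlonglongrightarrow> 1"
      unfolding g_def by (rule tendsto_eq_rhs[OF tendsto_power[OF tendsto_norm[OF M.tendsto_fourier[OF Si_tendsto_0]]]]) simp
    then have "(\<lambda>n. g x / g ((Si ^^ n) x)) \<longlonglongrightarrow> g x / 1" by (intro tendsto_intros) auto
    moreover have "\<forall>\<^sub>F n in sequentially. g ((Si ^^ n) x) > 0"
      using gl by (rule order_tendstoD) simp
    then have "\<forall>\<^sub>F n in sequentially. g x / g ((Si ^^ n) x) = p n x"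
    proof eventually_elim
      case (elim n)
      then show ?case by (subst g_eq[of x n]) simp
    qed
    ultimately show ?thesis by (simp add: tendsto_cong)
  qed
  have "(\<lambda>n. f ((Si ^^ n) x)) \<longlonglongrightarrow> 1" for x
    using isCont_tendsto_compose[OF f(4) Si_tendsto_0] f(3) by simp
  then have "(\<lambda>n. \<Sum>\<gamma>\<in>F. p n (t + \<gamma>) * f ((Si ^^ n) (t + \<gamma>))) \<longlonglongrightarrow> (\<Sum>\<gamma>\<in>F. g (t + \<gamma>) * 1)"
    by (intro tendsto_sum tendsto_mult p_lim)
  moreover have "\<forall>\<^sub>F n in sequentially. (\<Sum>\<gamma>\<in>F. p n (t + \<gamma>) * f ((Si ^^ n) (t + \<gamma>))) \<le> f t"
    using eventually_subset_G[OF F]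
  proof eventually_elim
    case (elim n)
    have "(T ^^ n) f = f" by (induction n) (simp_all add: f(2) del: transpose_matrix_vector)
    then have "f t = (\<Sum>\<gamma>\<in>G n. p n (t + \<gamma>) * f ((Si ^^ n) (t + \<gamma>)))" by (simp only: T_iterate[symmetric])
    also have "\<dots> \<ge> (\<Sum>\<gamma>\<in>F. p n (t + \<gamma>) * f ((Si ^^ n) (t + \<gamma>)))"
      by (intro sum_mono2 elim finite_digit_sums fin mult_nonneg_nonneg p_nonneg f)
    finally show ?case .
  qed
  ultimately have "(\<Sum>\<gamma>\<in>F. g (t + \<gamma>) * 1) \<le> f t" by (intro tendsto_upperbound[of _ _ sequentially]) auto
  then show "(\<Sum>\<gamma>\<in>F. g (t + \<gamma>)) \<le> f t" by simp
qed

section \<open>The order interval of fixed functions\<close>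

lemma E_plus_bounds: "f \<in> E_plus T \<Longrightarrow> \<sigma> t \<le> f t \<and> f t \<le> 1"
  using sigma_minimal[of f t] continuously_differentiable_isCont[of f 0]
  by (auto simp: E_plus_def image_subset_iff simp del: transpose_matrix_vector)

lemma one_in_E_plus: "(\<lambda>_. 1) \<in> E_plus T"
proof -
  have "continuously_differentiable (\<lambda>_ :: real ^ 'n. 1)"
    unfolding continuously_differentiable_def by (rule exI[of _ "\<lambda>_. 0"]) (simp add: zero_blinfun.rep_eq)
  then show ?thesis by (simp add: E_plus_def T_1 del: transpose_matrix_vector)
qed

lemma sigma_in_E_plus: "\<sigma> \<in> E_plus T"
  using sigma_C1 sigma_nonneg sigma_le_1 sigma_0 T_sigma unfolding E_plus_def by (auto simp del: transpose_matrix_vector)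

lemma E_plus_convex: "convex_functions (E_plus T)"
  unfolding convex_functions_def
proof (intro ballI)
  fix f h :: "real ^ 'n \<Rightarrow> real" and u :: real
  assume f: "f \<in> E_plus T" and h: "h \<in> E_plus T" and u: "u \<in> {0..1}"
  let ?k = "\<lambda>t. (1 - u) * f t + u * h t"
  obtain f' h' where d: "\<And>x. (f has_derivative blinfun_apply (f' x)) (at x)" "continuous_on UNIV f'"
     "\<And>x. (h has_derivative blinfun_apply (h' x)) (at x)" "continuous_on UNIV h'"
    using f h unfolding E_plus_def continuously_differentiable_def by blast
  have "continuously_differentiable ?k"
    unfolding continuously_differentiable_def
  proof (intro exI conjI allI)
    show "continuous_on UNIV (\<lambda>x. (1 - u) *\<^sub>R f' x + u *\<^sub>R h' x)" by (intro continuous_intros d)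
    show "(?k has_derivative blinfun_apply ((1 - u) *\<^sub>R f' x + u *\<^sub>R h' x)) (at x)" for x
      by (rule has_derivative_eq_rhs, (rule derivative_intros d)+) (simp add: blinfun.add_left blinfun.scaleR_left fun_eq_iff)
  qed
  moreover have "T ?k = ?k"
  proof
    fix t
    have "T ?k t = (1 - u) * T f t + u * T h t"
      unfolding transfer_op_def sum_distrib_left sum.distrib[symmetric]
      by (intro sum.cong refl) (simp add: algebra_simps)
    then show "T ?k t = ?k t" using f h by (simp add: E_plus_def del: transpose_matrix_vector)
  qed
  moreover have "?k t \<in> {0..1}" for t
  proof -
    have "0 \<le> f t" "f t \<le> 1" "0 \<le> h t" "h t \<le> 1" using f h by (auto simp: E_plus_def image_subset_iff)
    then show ?thesis using u convex_bound_le[of "f t" 1 "h t" "1 - u" u] by auto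
  qed
  moreover have "?k 0 = 1" using f h by (simp add: E_plus_def)
  ultimately show "?k \<in> E_plus T" by (auto simp: E_plus_def simp del: transpose_matrix_vector)
qed

lemma E_plus_eq_interval: "E_plus T = fixed_interval T \<sigma> (\<lambda>_. 1)"
proof (intro equalityI subsetI)
  fix f assume "f \<in> E_plus T"
  then show "f \<in> fixed_interval T \<sigma> (\<lambda>_. 1)"
    using E_plus_bounds[of f] by (simp add: E_plus_def fixed_interval_def del: transpose_matrix_vector)
next
  fix f assume f: "f \<in> fixed_interval T \<sigma> (\<lambda>_. 1)"
  then have b: "\<sigma> t \<le> f t" "f t \<le> 1" for t by (auto simp: fixed_interval_def)
  have "0 \<le> f t" for t using sigma_nonneg b(1) by (rule order_trans)
  moreover have "f 0 = 1" using b[of 0] sigma_0 by simp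
  ultimately show "f \<in> E_plus T"
    using f b by (auto simp: E_plus_def fixed_interval_def simp del: transpose_matrix_vector)
qed

end

theorem lemma4p1:
  fixes R :: "real ^ 'n ^ 'n" and B L :: "(real ^ 'n) set"
    and \<mu>B \<mu>L :: "(real ^ 'n) measure" and \<Gamma>B \<Gamma>L :: "(real ^ 'n) set"
    and TB TL :: "(real ^ 'n \<Rightarrow> real) \<Rightarrow> real ^ 'n \<Rightarrow> real"
    and specB specL :: "real ^ 'n \<Rightarrow> real"
  assumes "hadamard_system R B L"
    and "\<mu>B = ifs_measure R B" and "\<mu>L = ifs_measure (transpose R) L"
    and "\<Gamma>B = digit_set R B" and "\<Gamma>L = digit_set (transpose R) L"
    and "TB = transfer_op (transpose R) B L" and "TL = transfer_op R L B"
    and "specB = spectral_function \<mu>B \<Gamma>L" and "specL = spectral_function \<mu>L \<Gamma>B"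
  shows "(\<lambda>_. 1) \<in> E_plus TB \<inter> E_plus TL
     \<and> (\<forall>t. (\<lambda>\<gamma>. (cmod (fourier \<mu>B (t + \<gamma>)))\<^sup>2) summable_on \<Gamma>L)
     \<and> (\<forall>t. (\<lambda>\<xi>. (cmod (fourier \<mu>L (t + \<xi>)))\<^sup>2) summable_on \<Gamma>B)
     \<and> specB \<in> E_plus TB \<and> specL \<in> E_plus TL
     \<and> convex_functions (E_plus TB) \<and> convex_functions (E_plus TL)
     \<and> E_plus TB = fixed_interval TB specB (\<lambda>_. 1)
     \<and> E_plus TL = fixed_interval TL specL (\<lambda>_. 1)
     \<and> (\<forall>f\<in>E_plus TB. \<forall>t. specB t \<le> f t \<and> f t \<le> 1)
     \<and> (\<forall>f\<in>E_plus TL. \<forall>t. specL t \<le> f t \<and> f t \<le> 1)"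
proof -
  interpret HB: hadamard R B L by standard (rule assms(1))
  interpret HL: hadamard "transpose R" L B by standard (rule hadamard_system_transpose[OF assms(1)])
  note HB_results = HB.one_in_E_plus HB.sigma_in_E_plus HB.E_plus_convex HB.E_plus_eq_interval
    HB.E_plus_bounds HB.summable[unfolded HB.g_def]
  note HL_results = HL.one_in_E_plus HL.sigma_in_E_plus HL.E_plus_convex HL.E_plus_eq_interval
    HL.E_plus_bounds HL.summable[unfolded HL.g_def]
  show ?thesis
    unfolding assms(2-9)
    using HB_results HL_results[unfolded transpose_transpose] by blast
qed

end
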